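(* Let $V$ be an affine variety in $\mathbb{G}_m^n$ defined over $\mathbb{Q}$, given by polynomial equations $$\sum_{\mathbf i} a_{\ell \mathbf i}\,\mathbf x^{\mathbf i}=0\qquad(\ell=1,\dots,L)$$ with rational coefficients $a_{\ell\mathbf i}$, of total degree $d$ (the maximum of the total degrees of the $L$ polynomials). Suppose that the set $$\mathcal N(V)=\{\mathbf i\in\mathbb{Z}^n \mid a_{\ell\mathbf i}\neq 0 \text{ for some } \ell\}$$ has diameter $D(V)$ (in the Euclidean metric). Let $N:=\#\mathcal N(V)$, so that $N\leq\binom{n+d}{d}$, and let $P_N$ be the product of all primes up to $N$. Then every $(n-k)$-dimensional maximal torsion coset on $V$ has an exponent $mP_N$ for some positive integer $m\leq D(V)^{2k}k^{k/2}$.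
   Context: $\mathbb{G}_m=\mathbb{C}^*$ is the multiplicative group of $\mathbb{C}$, and $\mathbb{G}_m^n=\{(x_1,\dots,x_n)\mid x_i\neq 0\}$; for $\mathbf i=(i_1,\dots,i_n)$, $\mathbf x^{\mathbf i}=x_1^{i_1}\cdots x_n^{i_n}$. Varieties are not assumed irreducible. An $r$-dimensional subtorus $H$ of $\mathbb{G}_m^n$ is a subgroup of the form $H=\{(x_1,\dots,x_n)\mid x_i=t_1^{e_{1i}}\cdots t_r^{e_{ri}},\ t_1,\dots,t_r\in\mathbb{G}_m\}$ for some $r\times n$ integer matrix $E=(e_{ji})$ of rank $r$. A torsion coset is a translate $\boldsymbol\omega H$ of a subtorus $H$ by a point $\boldsymbol\omega=(\omega_1,\dots,\omega_n)$ all of whose coordinates are roots of unity; its dimension is that of $H$. An exponent of $\boldsymbol\omega H$ is any (positive) multiple of the order of $\boldsymbol\omega H$ as an element of the group $\mathbb{G}_m^n/H$. A maximal torsion coset on (or of) a variety $V\subset\mathbb{G}_m^n$ is a torsion coset contained in $V$ and not properly contained in any other torsion coset contained in $V$. *)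

theory Defs
  imports
    "HOL-Analysis.Analysis"
    "HOL-Algebra.Multiplicative_Group"
    "HOL-Library.Poly_Mapping"
    "HOL-Computational_Algebra.Primes"
begin

text \<open>
  A polynomial in \<open>n = CARD('n)\<close> variables over the rationals is a finitely supported map from
  exponent vectors to coefficients.
\<close>

type_synonym 'n rat_mpoly = "(nat ^ 'n) \<Rightarrow>\<^sub>0 rat"

definition mpoly_eval :: "'n::finite rat_mpoly \<Rightarrow> complex ^ 'n \<Rightarrow> complex" where
  "mpoly_eval p x =
     (\<Sum>i \<in> Poly_Mapping.keys p. of_rat (Poly_Mapping.lookup p i) * (\<Prod>j\<in>UNIV. (x $ j) ^ (i $ j)))"

definition mpoly_total_degree :: "'n::finite rat_mpoly \<Rightarrow> nat" where
  "mpoly_total_degree p = Max (insert 0 ((\<lambda>i. \<Sum>j\<in>UNIV. i $ j) ` Poly_Mapping.keys p))"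

text \<open>A system of \<open>L\<close> polynomials is given by the values \<open>f 1, \<dots>, f L\<close>.\<close>

definition system_degree :: "nat \<Rightarrow> (nat \<Rightarrow> 'n::finite rat_mpoly) \<Rightarrow> nat" where
  "system_degree L f = Max (insert 0 ((\<lambda>l. mpoly_total_degree (f l)) ` {1..L}))"

definition system_support :: "nat \<Rightarrow> (nat \<Rightarrow> 'n::finite rat_mpoly) \<Rightarrow> (nat ^ 'n) set" where
  "system_support L f = {i. \<exists>l\<in>{1..L}. Poly_Mapping.lookup (f l) i \<noteq> 0}"

definition exponent_diameter :: "(nat ^ 'n::finite) set \<Rightarrow> real" where
  "exponent_diameter S = diameter ((\<lambda>i. (\<chi> j. real (i $ j)) :: real ^ 'n) ` S)"

text \<open>Multiplication and unit of \<^typ>\<open>complex ^ 'n\<close> are componentwise.\<close>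

definition Gm :: "(complex ^ 'n::finite) monoid" where
  "Gm = \<lparr>carrier = {x. \<forall>i. x $ i \<noteq> 0}, monoid.mult = (*), one = 1\<rparr>"

definition Gm_variety :: "nat \<Rightarrow> (nat \<Rightarrow> 'n::finite rat_mpoly) \<Rightarrow> (complex ^ 'n) set" where
  "Gm_variety L f = {x \<in> carrier Gm. \<forall>l\<in>{1..L}. mpoly_eval (f l) x = 0}"

text \<open>
  The rows of the \<open>r \<times> n\<close> integer matrix are \<open>E 1, \<dots>, E r\<close>; its rank is the dimension of the span
  of its rows, so the first conjunct says that the matrix has rank \<open>r\<close>.
\<close>

definition subtorus :: "nat \<Rightarrow> (complex ^ 'n::finite) set \<Rightarrow> bool" where
  "subtorus r H \<longleftrightarrow>
     (\<exists>E :: nat \<Rightarrow> int ^ 'n.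
        dim ((\<lambda>j. (\<chi> i. real_of_int (E j $ i)) :: real ^ 'n) ` {1..r}) = r \<and>
        H = {x. \<exists>t :: nat \<Rightarrow> complex. (\<forall>j\<in>{1..r}. t j \<noteq> 0) \<and>
                 (\<forall>i. x $ i = (\<Prod>j\<in>{1..r}. t j powi (E j $ i)))})"

text \<open>\<open>torsion_coset r H C\<close>: the set \<open>C\<close> is a torsion coset \<open>\<omega>H\<close> with \<open>H\<close> an \<open>r\<close>-dimensional subtorus.\<close>

definition torsion_coset :: "nat \<Rightarrow> (complex ^ 'n::finite) set \<Rightarrow> (complex ^ 'n) set \<Rightarrow> bool" where
  "torsion_coset r H C \<longleftrightarrow>
     subtorus r H \<and>
     (\<exists>\<omega> :: complex ^ 'n. (\<forall>i. \<exists>q>0. (\<omega> $ i) ^ q = 1) \<and> C = \<omega> <#\<^bsub>Gm\<^esub> H)"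

definition maximal_torsion_coset ::
    "(complex ^ 'n::finite) set \<Rightarrow> nat \<Rightarrow> (complex ^ 'n) set \<Rightarrow> (complex ^ 'n) set \<Rightarrow> bool" where
  "maximal_torsion_coset V r H C \<longleftrightarrow>
     torsion_coset r H C \<and> C \<subseteq> V \<and>
     \<not> (\<exists>r' H' C'. torsion_coset r' H' C' \<and> C' \<subseteq> V \<and> C \<subset> C')"

text \<open>
  \<^const>\<open>group.ord\<close> is \<open>0\<close> on elements of infinite order, which therefore have no positive multiple
  of it as exponent.
\<close>

definition coset_exponent :: "(complex ^ 'n::finite) set \<Rightarrow> (complex ^ 'n) set \<Rightarrow> nat \<Rightarrow> bool" where
  "coset_exponent H C e \<longleftrightarrow> e > 0 \<and> group.ord (Gm Mod H) C dvd e"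

lemma comm_group_Gm: "comm_group (Gm :: (complex ^ 'n::finite) monoid)"
proof (rule comm_groupI)
  fix x :: "complex ^ 'n" assume x: "x \<in> carrier Gm"
  show "\<exists>y\<in>carrier Gm. y \<otimes>\<^bsub>Gm\<^esub> x = \<one>\<^bsub>Gm\<^esub>"
    using x by (intro bexI[of _ "\<chi> i. inverse (x $ i)"]) (auto simp: Gm_def vec_eq_iff)
qed (auto simp: Gm_def mult_ac)

lemma subgroup_subtorus:
  assumes "subtorus r (H :: (complex ^ 'n::finite) set)"
  shows "subgroup H Gm"
proof -
  interpret comm_group "Gm :: (complex ^ 'n) monoid" by (rule comm_group_Gm)
  obtain E :: "nat \<Rightarrow> int ^ 'n" where
    H: "H = {x. \<exists>t :: nat \<Rightarrow> complex. (\<forall>j\<in>{1..r}. t j \<noteq> 0) \<and>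
                 (\<forall>i. x $ i = (\<Prod>j\<in>{1..r}. t j powi (E j $ i)))}"
    using assms unfolding subtorus_def by blast
  have sub: "H \<subseteq> carrier Gm"
    by (auto simp: H Gm_def)
  show ?thesis
  proof (rule subgroupI)
    show "H \<noteq> {}"
    proof -
      have "1 \<in> H" unfolding H by (auto intro!: exI[of _ "\<lambda>_. 1"])
      then show ?thesis by blast
    qed
  next
    fix x assume x: "x \<in> H"
    then obtain t where t: "\<forall>j\<in>{1..r}. t j \<noteq> 0"
        "\<forall>i. x $ i = (\<Prod>j\<in>{1..r}. t j powi (E j $ i))"
      unfolding H by blast
    let ?y = "\<chi> i. inverse (x $ i)"
    have "?y \<in> H" unfolding H
      using t by (auto intro!: exI[of _ "\<lambda>j. inverse (t j)"] simp: power_int_inverse prod_inversef[unfolded o_def, symmetric])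
    moreover have "inv\<^bsub>Gm\<^esub> x = ?y"
    proof (rule inv_equality)
      show "?y \<otimes>\<^bsub>Gm\<^esub> x = \<one>\<^bsub>Gm\<^esub>" "x \<in> carrier Gm" "?y \<in> carrier Gm"
        using sub x by (auto simp: Gm_def vec_eq_iff)
    qed
    ultimately show "inv\<^bsub>Gm\<^esub> x \<in> H" by simp
  next
    fix x y assume "x \<in> H" "y \<in> H"
    then obtain s t where "\<forall>j\<in>{1..r}. s j \<noteq> 0" "\<forall>j\<in>{1..r}. t j \<noteq> 0"
        "\<forall>i. x $ i = (\<Prod>j\<in>{1..r}. s j powi (E j $ i))"
        "\<forall>i. y $ i = (\<Prod>j\<in>{1..r}. t j powi (E j $ i))"
      unfolding H by blast
    then show "x \<otimes>\<^bsub>Gm\<^esub> y \<in> H" unfolding H Gm_def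
      by (auto intro!: exI[of _ "\<lambda>j. s j * t j"] simp: power_int_mult_distrib prod.distrib)
  qed (use sub in auto)
qed

lemma torsion_coset_in_carrier:
  assumes "torsion_coset r (H :: (complex ^ 'n::finite) set) C"
  shows "C \<in> carrier (Gm Mod H)"
proof -
  interpret comm_group "Gm :: (complex ^ 'n) monoid" by (rule comm_group_Gm)
  obtain \<omega> :: "complex ^ 'n" where \<omega>: "\<forall>i. \<exists>q>0. (\<omega> $ i) ^ q = 1" "C = \<omega> <#\<^bsub>Gm\<^esub> H"
    using assms unfolding torsion_coset_def by blast
  have "\<omega> $ i \<noteq> 0" for i
    using \<omega>(1) by (metis power_0_left less_numeral_extra(3) zero_neq_one)
  then have "\<omega> \<in> carrier Gm" by (simp add: Gm_def)
  moreover have "C = H #>\<^bsub>Gm\<^esub> \<omega>"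
    by (simp add: \<omega>(2) l_coset_def r_coset_def Gm_def mult.commute)
  ultimately show ?thesis
    by (auto simp: FactGroup_def RCOSETS_def)
qed

end

theory Submission
  imports Defs "HOL-Number_Theory.Cong"
begin

text \<open>
  Restricted to a torsion coset \<open>\<omega>H \<subseteq> V\<close>, every defining equation splits into rational relations between
  roots of unity, one for each character of \<open>H\<close>, and these split further into minimal vanishing
  sums. The differences of the exponent vectors inside the minimal sums form a set \<open>M\<close> of integer
  vectors. By Mann's theorem \<open>\<omega>\<^sup>P\<close> is annihilated by \<open>M\<close>. Conversely, if \<open>x\<close> is annihilated by \<open>M\<close> then
  \<open>\<omega>x \<in> V\<close>, so by maximality \<open>H\<close> is a full subtorus \<open>H'\<close> annihilated by \<open>M\<close>, and
  \<open>k = dim (span M)\<close>.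

  Complete a basis of \<open>span M\<close> consisting of \<open>k\<close> elements of \<open>M\<close> to a basis of the whole space by standard
  unit vectors, and let \<open>A\<close> be the resulting integer matrix. The columns of the adjugate of \<open>A\<close> that belong to
  the unit vectors parametrise \<open>H'\<close>, and the adjugate identity shows that \<open>x\<^sup>m \<in> H'\<close> for
  \<open>m = \<bar>det A\<bar>\<close> and every \<open>x\<close> annihilated by \<open>M\<close>; hence \<open>mP\<close> is an exponent. As the entries are
  integers, the sum of the absolute values in a row is at most the square of its Euclidean norm,
  whence \<open>m \<le> D\<^sup>2\<^sup>k\<close>.
\<close>

hide_const (open) Module.smult UnivPoly.monom UnivPoly.coeff Henstock_Kurzweil_Integration.content

section \<open>Conjugate roots of unity\<close>

text \<open>As \<open>f\<close> varies, the values at a fixed \<open>z\<close> form the ring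
  \<open>\<int>[z]\<close>; a congruence modulo \<open>p\<close> in that ring is thus expressed by
  an explicit integer polynomial as witness.\<close>

definition int_poly_eval :: "int poly \<Rightarrow> complex \<Rightarrow> complex" where
  "int_poly_eval f z = poly (map_poly of_int f) z"

lemma int_poly_eval_0 [simp]: "int_poly_eval 0 z = 0"
  by (simp add: int_poly_eval_def)

lemma int_poly_eval_pCons [simp]:
  "int_poly_eval (pCons a f) z = of_int a + z * int_poly_eval f z"
  by (simp add: int_poly_eval_def map_poly_pCons)

lemma int_poly_eval_1 [simp]: "int_poly_eval 1 z = 1"
  by (simp add: one_pCons)

lemma int_poly_eval_add [simp]:
  "int_poly_eval (f + g) z = int_poly_eval f z + int_poly_eval g z"
  by (induction f g rule: poly_induct2) (simp_all add: algebra_simps)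

lemma int_poly_eval_smult [simp]:
  "int_poly_eval (smult c f) z = of_int c * int_poly_eval f z"
  by (induction f) (simp_all add: algebra_simps)

lemma int_poly_eval_minus [simp]:
  "int_poly_eval (- f) z = - int_poly_eval f z"
  using int_poly_eval_smult[of "-1" f z] by simp

lemma int_poly_eval_diff [simp]:
  "int_poly_eval (f - g) z = int_poly_eval f z - int_poly_eval g z"
  using int_poly_eval_add[of f "- g" z] by simp

lemma int_poly_eval_mult [simp]:
  "int_poly_eval (f * g) z = int_poly_eval f z * int_poly_eval g z"
  by (induction f) (simp_all add: algebra_simps)

lemma int_poly_eval_power [simp]:
  "int_poly_eval (f ^ n) z = int_poly_eval f z ^ n"
  by (induction n) simp_all

lemma int_poly_eval_sum [simp]:
  "int_poly_eval (\<Sum>i\<in>A. f i) z = (\<Sum>i\<in>A. int_poly_eval (f i) z)"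
  by (induction A rule: infinite_finite_induct) simp_all

lemma int_poly_eval_monom [simp]: "int_poly_eval (monom a n) z = of_int a * z ^ n"
  by (simp add: int_poly_eval_def map_poly_monom poly_monom)

section \<open>Congruences for \<open>p\<close>-th powers\<close>

lemma prime_dvd_binomial_power:
  fixes x y :: "'a::comm_ring_1"
  assumes "prime p"
  shows "of_nat p dvd (x + y) ^ p - x ^ p - y ^ p"
proof -
  have "p > 0" using assms prime_gt_0_nat by blast
  have "(x + y) ^ p = (\<Sum>k\<in>{..p}. of_nat (p choose k) * x ^ k * y ^ (p - k))"
    by (rule binomial_ring)
  also have "\<dots> = (\<Sum>k\<in>{0,p}. of_nat (p choose k) * x ^ k * y ^ (p - k)) +
      (\<Sum>k\<in>{..p} - {0,p}. of_nat (p choose k) * x ^ k * y ^ (p - k))"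
    by (subst sum.subset_diff[of "{0,p}"]) (auto simp: add.commute)
  also have "(\<Sum>k\<in>{0,p}. of_nat (p choose k) * x ^ k * y ^ (p - k)) = x ^ p + y ^ p"
    using \<open>p > 0\<close> by simp
  finally have "(x + y) ^ p - x ^ p - y ^ p =
      (\<Sum>k\<in>{..p} - {0,p}. of_nat (p choose k) * x ^ k * y ^ (p - k))" by simp
  also have "of_nat p dvd \<dots>"
  proof (intro dvd_sum dvd_mult2)
    fix k assume "k \<in> {..p} - {0,p}"
    then have "p dvd (p choose k)"
      by (intro dvd_choose_prime assms) auto
    then show "of_nat p dvd (of_nat (p choose k) :: 'a)"
      by (metis dvd_def of_nat_mult)
  qed
  finally show ?thesis .
qed

lemma fermat_int:
  fixes a :: int
  assumes "prime p"
  shows "int p dvd a ^ p - a"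
proof -
  have step: "int p dvd (b + 1) ^ p - b ^ p - 1" for b
    using prime_dvd_binomial_power[OF assms, of b 1] by simp
  show ?thesis
  proof (induction a rule: int_induct[where k = 0])
    case base
    then show ?case using assms prime_gt_0_nat by (simp add: power_0_left)
  next
    case (step1 a)
    have "(a + 1) ^ p - (a + 1) = ((a + 1) ^ p - a ^ p - 1) + (a ^ p - a)" by simp
    then show ?case using step1(2) step[of a] dvd_add by metis
  next
    case (step2 a)
    have "(a - 1) ^ p - (a - 1) = (a ^ p - a) - (((a - 1) + 1) ^ p - (a - 1) ^ p - 1)" by simp
    then show ?case using step2(2) step[of "a - 1"] dvd_diff by metis
  qed
qed

text \<open>Modulo \<open>p\<close>, raising to the \<open>p\<close>-th power is additive and fixes
  integers, so \<open>h(X ^ p)\<close> and \<open>h(X) ^ p\<close> agree. One error polynomial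
  \<open>w\<close> serves all \<open>z\<close>.\<close>

lemma int_poly_eval_frobenius:
  assumes "prime p"
  shows "\<exists>w. \<forall>z. int_poly_eval h (z ^ p) = int_poly_eval h z ^ p + of_nat p * int_poly_eval w z"
proof (induction h)
  case 0
  show ?case using assms prime_gt_0_nat by (intro exI[of _ 0]) (simp add: power_0_left)
next
  case (pCons a h)
  obtain w where w: "int_poly_eval h (z ^ p) = int_poly_eval h z ^ p + of_nat p * int_poly_eval w z" for z
    using pCons.IH by blast
  obtain c where c: "([:a:] + pCons 0 h) ^ p - [:a:] ^ p - pCons 0 h ^ p = of_nat p * c"
    using prime_dvd_binomial_power[OF assms] by (metis dvdE)
  obtain b where b: "a ^ p - a = int p * b"
    using fermat_int[OF assms] by (metis dvdE)
  have *: "int_poly_eval (of_nat p * c) z = of_nat p * int_poly_eval c z" for z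
    by (simp add: of_nat_poly)
  have "int_poly_eval (([:a:] + pCons 0 h) ^ p - [:a:] ^ p - pCons 0 h ^ p) z
      = of_nat p * int_poly_eval c z" for z
    unfolding c * ..
  then have c': "(of_int a + z * int_poly_eval h z) ^ p =
      of_int a ^ p + z ^ p * int_poly_eval h z ^ p + of_nat p * int_poly_eval c z" for z
    by (simp add: power_mult_distrib algebra_simps del: pCons_0_0)
  have b': "of_int a ^ p - (of_int a :: complex) = of_nat p * of_int b"
    using arg_cong[OF b, of "of_int :: int \<Rightarrow> complex"] by simp
  show ?case
  \<comment> \<open>The three terms correct, in turn, the congruence for \<open>h\<close> multiplied
    by \<open>z ^ p\<close>, the mixed binomial terms, and the replacement of \<open>a\<close> by
    \<open>a ^ p\<close>.\<close>
  proof (intro exI[of _ "monom 1 p * w - c - [:b:]"] allI)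
    fix z
    have "int_poly_eval (pCons a h) (z ^ p) = of_int a + z ^ p * (int_poly_eval h z ^ p + of_nat p * int_poly_eval w z)"
      by (simp add: w)
    also have "\<dots> = int_poly_eval (pCons a h) z ^ p + of_nat p * int_poly_eval (monom 1 p * w - c - [:b:]) z"
      using b' by (simp add: c' algebra_simps)
    finally show "int_poly_eval (pCons a h) (z ^ p) =
      int_poly_eval (pCons a h) z ^ p + of_nat p * int_poly_eval (monom 1 p * w - c - [:b:]) z" .
  qed
qed

text \<open>Take the primitive part of a nonzero integer polynomial of least degree vanishing at
  \<open>z\<close>. Gauss's lemma turns divisibility up to a constant into divisibility over the
  integers; as \<open>X ^ n - 1\<close> is monic, the leading coefficient is a unit.\<close>

lemma minimal_int_poly:
  assumes "z ^ n = 1" "n > 0"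
  obtains g where "content g = 1" "degree g > 0" "\<bar>lead_coeff g\<bar> = 1" "int_poly_eval g z = 0"
    "\<And>f. int_poly_eval f z = 0 \<Longrightarrow> g dvd f"
proof -
  define m :: "int poly" where "m = monom 1 n - 1"
  have m: "int_poly_eval m z = 0" "m \<noteq> 0" "lead_coeff m = 1"
  proof -
    show "int_poly_eval m z = 0" using assms by (simp add: m_def)
    have "degree m = n" unfolding m_def using assms(2)
      by (subst diff_conv_add_uminus, subst degree_add_eq_left) (simp_all add: degree_monom_eq)
    then show "lead_coeff m = 1" using assms(2) by (simp add: m_def)
    then show "m \<noteq> 0" by auto
  qed
  define Q where "Q = (\<lambda>g. g \<noteq> 0 \<and> int_poly_eval g z = 0)"
  have "\<exists>g. Q g \<and> (\<forall>f. Q f \<longrightarrow> degree g \<le> degree f)"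
    using m by (intro ex_has_least_nat[of Q m degree]) (auto simp: Q_def)
  then obtain g0 where g0: "Q g0" "\<And>f. Q f \<Longrightarrow> degree g0 \<le> degree f" by blast
  define g where "g = primitive_part g0"
  have g0_eq: "g0 = smult (content g0) g" by (simp add: g_def)
  have cg: "content g = 1" using g0(1) by (simp add: g_def Q_def)
  have gz: "int_poly_eval g z = 0"
  proof -
    have "of_int (content g0) * int_poly_eval g z = 0"
      using g0(1) int_poly_eval_smult[of "content g0" g z] by (simp add: Q_def g_def)
    then show ?thesis using g0(1) by (simp add: Q_def)
  qed
  have deg: "degree g = degree g0" by (simp add: g_def)
  have "g \<noteq> 0" using cg by auto
  have dvd: "g dvd f" if "int_poly_eval f z = 0" for f
  proof -
    obtain a q where aq: "a \<noteq> 0" "smult a f = g * q + pseudo_mod f g"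
      using pseudo_mod(1)[OF \<open>g \<noteq> 0\<close>] by blast
    have "int_poly_eval (smult a f) z = 0" using that by simp
    then have "int_poly_eval (pseudo_mod f g) z = 0" unfolding aq(2) by (simp add: gz)
    then have "pseudo_mod f g = 0"
      using pseudo_mod(2)[OF \<open>g \<noteq> 0\<close>, of f] g0(2)[of "pseudo_mod f g"] deg
      unfolding Q_def by linarith
    then have eq: "smult a f = g * q" using aq by simp
    \<comment> \<open>Since \<open>g\<close> is primitive, contents show that the factor
      \<open>a\<close> from pseudo-division divides \<open>q\<close> and can be cancelled.\<close>
    then have "content (smult a f) = content q" by (simp add: content_mult cg)
    then have "a dvd content q" by (metis content_smult dvd_triv_left normalize_dvd_iff)
    then have "[:a:] dvd q" by (simp add: const_poly_dvd_iff_dvd_content)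
    then obtain q' where "q = [:a:] * q'" by (elim dvdE)
    then have "smult a f = smult a (g * q')" using eq by simp
    then have "f = g * q'" using aq(1) by (metis smult_cancel)
    then show ?thesis by simp
  qed
  have "degree g > 0"
  proof (rule ccontr)
    assume "\<not> degree g > 0"
    then obtain c where "g = [:c:]" by (metis degree_eq_zeroE gr0I)
    then show False using gz \<open>g \<noteq> 0\<close> by simp
  qed
  moreover have "\<bar>lead_coeff g\<bar> = 1"
  proof -
    have "lead_coeff g dvd lead_coeff m"
      using dvd[OF m(1)] by (metis dvd_def lead_coeff_mult)
    then show ?thesis using m(3) by simp
  qed
  ultimately show ?thesis using that cg gz dvd by blast
qed

lemma int_poly_eval_pderiv_mult:
  "int_poly_eval (pderiv (f * g)) z =
     int_poly_eval f z * int_poly_eval (pderiv g) z + int_poly_eval g z * int_poly_eval (pderiv f) z"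
  by (simp add: pderiv_mult)

text \<open>
  Let \<open>g\<close> be the minimal polynomial of \<open>z\<close> and \<open>X ^ n - 1 = g h\<close>. If \<open>z ^ p\<close> is not a root of \<open>g\<close>, it is
  a root of \<open>h\<close>, so \<open>p\<close> divides \<open>h(z) ^ p\<close> in \<open>\<int>[z]\<close>. Differentiating, \<open>n z ^ (n - 1) = g'(z) h(z)\<close>,
  so \<open>p\<close> divides \<open>n ^ p\<close> in \<open>\<int>[z]\<close> and hence, by minimality of \<open>g\<close>, in \<open>\<int>\<close>.
\<close>

lemma root_of_unity_conjugate_prime:
  assumes z: "z ^ n = 1" "n > 0" and p: "prime p" "\<not> p dvd n" and f: "int_poly_eval f z = 0"
  shows "int_poly_eval f (z ^ p) = 0"
proof (rule ccontr)
  assume nz: "int_poly_eval f (z ^ p) \<noteq> 0"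
  obtain g where g: "content g = 1" "degree g > 0" "\<bar>lead_coeff g\<bar> = 1" "int_poly_eval g z = 0"
    "\<And>f. int_poly_eval f z = 0 \<Longrightarrow> g dvd f"
    using minimal_int_poly[OF z] by blast
  have "int_poly_eval (monom 1 n - 1) z = 0" using z by simp
  then obtain h where h: "monom 1 n - 1 = g * h" using g(5) by (metis dvdE)
  obtain f' where "f = g * f'" using g(5)[OF f] by (metis dvdE)
  then have "int_poly_eval g (z ^ p) \<noteq> 0" using nz by auto
  moreover have "int_poly_eval (g * h) (z ^ p) = 0"
    unfolding h[symmetric] using z by (simp flip: power_mult) (simp add: mult.commute power_mult)
  ultimately have "int_poly_eval h (z ^ p) = 0" by simp
  moreover obtain w where
    w: "\<And>z. int_poly_eval h (z ^ p) = int_poly_eval h z ^ p + of_nat p * int_poly_eval w z"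
    using int_poly_eval_frobenius[OF p(1)] by blast
  ultimately have hz: "int_poly_eval h z ^ p = - of_nat p * int_poly_eval w z"
    by (metis add_eq_0_iff mult_minus_left add.commute minus_equation_iff)
  have "int_poly_eval (pderiv (monom 1 n - 1)) z = int_poly_eval h z * int_poly_eval (pderiv g) z"
    unfolding h int_poly_eval_pderiv_mult by (simp add: g)
  then have dz: "of_nat n * z ^ (n - 1) = int_poly_eval h z * int_poly_eval (pderiv g) z"
    by (simp add: pderiv_diff pderiv_monom)
  have zz: "z ^ (n - 1) * z = 1" using z by (metis power_minus_mult)
  have "of_nat n = of_nat n * z ^ (n - 1) * z" using zz by simp
  then have "of_nat n ^ p = (int_poly_eval h z * int_poly_eval (pderiv g) z * z) ^ p"
    unfolding dz by simp
  then have nz': "of_nat n ^ p = of_nat p * int_poly_eval (- w * pderiv g ^ p * monom 1 p) z"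
    by (simp add: power_mult_distrib hz)
  define v where "v = - w * pderiv g ^ p * monom 1 p"
  have "g \<noteq> 0" using g(2) by auto
  obtain q r where qr: "pseudo_divmod v g = (q, r)" by fastforce
  define c where "c = lead_coeff g ^ (Suc (degree v) - degree g)"
  have v: "smult c v = g * q + r" "r = 0 \<or> degree r < degree g"
    using pseudo_divmod[OF \<open>g \<noteq> 0\<close> qr] by (auto simp: c_def)
  have "\<bar>c\<bar> = 1" using g(3) by (simp add: c_def power_abs)
  have rz: "int_poly_eval r z = of_int c * int_poly_eval v z"
    using arg_cong[OF v(1), of "\<lambda>f. int_poly_eval f z"] g(4) by simp
  \<comment> \<open>Pseudo-division by \<open>g\<close> replaces \<open>v\<close> by a remainder
    \<open>r\<close> of smaller degree at the cost of the unit \<open>c\<close>. So \<open>F\<close>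
    vanishes at \<open>z\<close> but has degree below that of \<open>g\<close>; hence it is zero,
    and its constant coefficient gives the divisibility in the integers.\<close>
  define F where "F = [:c * int n ^ p:] - smult (int p) r"
  have "int_poly_eval F z = 0"
    using nz' unfolding v_def[symmetric] by (simp add: F_def rz)
  then have "g dvd F" by (rule g(5))
  moreover have "degree F < degree g"
    unfolding F_def using g(2) v(2) by (intro degree_diff_less) (auto intro: le_less_trans[OF degree_smult_le])
  ultimately have "F = 0" by (metis dvd_imp_degree_le not_le)
  then have "coeff F 0 = 0" by simp
  then have "c * int n ^ p = int p * coeff r 0" by (simp add: F_def)
  then have "int p dvd c * int n ^ p" by simp
  then have "int p dvd int n ^ p" using \<open>\<bar>c\<bar> = 1\<close> by (metis abs_eq_iff' dvd_minus_iff mult_1 mult_minus1)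
  then have "p dvd n ^ p" by (metis of_nat_power of_nat_dvd_iff)
  then show False using p prime_dvd_power_nat by blast
qed

text \<open>Build \<open>u\<close> up one prime factor at a time: every intermediate power of
  \<open>z\<close> is again an \<open>n\<close>-th root of unity, so the prime case applies to
  it.\<close>

lemma root_of_unity_conjugate:
  assumes z: "z ^ n = 1" "n > 0" and "coprime u n" and f: "int_poly_eval f z = 0"
  shows "int_poly_eval f (z ^ u) = 0"
proof (cases "u = 0")
  case True
  \<comment> \<open>Coprimality of \<open>0\<close> and \<open>n\<close> forces
    \<open>n = 1\<close>, hence \<open>z = 1\<close>.\<close>
  then have "n = 1" using assms by simp
  then show ?thesis using assms True by simp
next
  case False
  then show ?thesis using \<open>coprime u n\<close>
  proof (induction u rule: prime_divisors_induct)
    case zero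
    then show ?case by simp
  next
    case (unit u)
    then show ?case using f by simp
  next
    case (factor p u)
    have "(z ^ u) ^ n = 1" using z by (metis mult.commute power_mult power_one)
    moreover have "\<not> p dvd n" using factor.prems factor.hyps
      by (metis coprime_mult_left_iff not_prime_unit coprime_absorb_left)
    moreover have "int_poly_eval f (z ^ u) = 0" using factor by auto
    ultimately have "int_poly_eval f ((z ^ u) ^ p) = 0"
      using root_of_unity_conjugate_prime z(2) factor.hyps by blast
    then show ?case by (simp add: mult.commute flip: power_mult)
  qed
qed

section \<open>From integer polynomials to rational relations\<close>

lemma common_denominator:
  fixes a :: "'i \<Rightarrow> rat"
  assumes "finite S"
  shows "\<exists>M b. M \<noteq> 0 \<and> (\<forall>i\<in>S. of_int M * a i = of_int (b i))"
  using assms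
proof (induction S)
  case empty
  show ?case by (intro exI[of _ 1]) simp
next
  case (insert j S)
  then obtain M b where M: "M \<noteq> 0" "\<forall>i\<in>S. of_int M * a i = of_int (b i)" by blast
  obtain c d where cd: "a j = of_int c / of_int d" "d \<noteq> 0"
    by (metis Rat_cases Fract_of_int_quotient less_irrefl)
  show ?case
  proof (intro exI[of _ "M * d"] exI[of _ "(\<lambda>i. d * b i)(j := M * c)"] conjI ballI)
    fix i assume "i \<in> insert j S"
    then show "of_int (M * d) * a i = of_int (((\<lambda>i. d * b i)(j := M * c)) i)"
      using M(2) cd insert.hyps by (auto simp: algebra_simps)
  qed (use M cd in auto)
qed

text \<open>This is the Galois action of \<open>u\<close> on the \<open>n\<close>-th cyclotomic
  field. All roots are powers of \<open>w = exp (2 pi i / n)\<close>, so after clearing denominators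
  the relation becomes an integer polynomial vanishing at \<open>w\<close>.\<close>

lemma rational_relation_conjugate:
  fixes a :: "'i \<Rightarrow> rat" and \<zeta> :: "'i \<Rightarrow> complex"
  assumes "finite S" "n > 0" "\<And>i. i \<in> S \<Longrightarrow> \<zeta> i ^ n = 1" "coprime u n"
    and "(\<Sum>i\<in>S. of_rat (a i) * \<zeta> i) = 0"
  shows "(\<Sum>i\<in>S. of_rat (a i) * \<zeta> i ^ u) = 0"
proof -
  define w where "w = cis (2 * pi / n)"
  have "real n * (2 * pi / real n) = 2 * pi" using assms(2) by simp
  then have w: "w ^ n = 1" by (metis w_def Complex.DeMoivre cis_2pi)
  have "\<exists>e. \<zeta> i = w ^ e" if "i \<in> S" for i
  proof -
    have "\<zeta> i \<in> {z. z ^ n = 1}" using assms(3)[OF that] by simp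
    also have "\<dots> = (\<lambda>k. cis (2 * pi * real k / real n)) ` {..<n}"
      using bij_betw_imp_surj_on[OF Complex.bij_betw_roots_unity[OF assms(2)]] by (rule sym)
    finally obtain k where "\<zeta> i = cis (2 * pi * real k / real n)" by blast
    also have "\<dots> = w ^ k" unfolding w_def Complex.DeMoivre by (simp only: times_divide_eq_right mult.commute)
    finally have "\<zeta> i = w ^ k" .
    then show ?thesis ..
  qed
  then obtain e where e: "\<And>i. i \<in> S \<Longrightarrow> \<zeta> i = w ^ e i" by metis
  obtain M b where M: "M \<noteq> 0" "\<And>i. i \<in> S \<Longrightarrow> of_int M * a i = of_int (b i)"
    using common_denominator[OF assms(1), of a] by metis
  have M': "of_int M * (of_rat (a i) :: complex) = of_int (b i)" if "i \<in> S" for i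
    using arg_cong[OF M(2)[OF that], of "of_rat :: rat \<Rightarrow> complex"] by (simp add: of_rat_mult)
  define f where "f = (\<Sum>i\<in>S. Polynomial.monom (b i) (e i))"
  have f: "int_poly_eval f (w ^ v) = of_int M * (\<Sum>i\<in>S. of_rat (a i) * \<zeta> i ^ v)" for v
  proof -
    have "int_poly_eval f (w ^ v) = (\<Sum>i\<in>S. of_int M * of_rat (a i) * \<zeta> i ^ v)"
      unfolding f_def int_poly_eval_sum
      by (intro sum.cong refl) (simp add: e M' mult.commute flip: power_mult)
    then show ?thesis by (simp add: sum_distrib_left mult.assoc)
  qed
  have "int_poly_eval f w = 0" using f[of 1] assms(5) by simp
  then have "int_poly_eval f (w ^ u) = 0"
    using root_of_unity_conjugate[OF w assms(2) assms(4)] by blast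
  then show ?thesis using f[of u] M(1) by simp
qed

section \<open>Mann's theorem\<close>

lemma sum_powers_root_of_unity:
  fixes x :: complex
  assumes "x ^ p = 1"
  shows "(\<Sum>t<p. x ^ t) = (if x = 1 then of_nat p else 0)"
  using assms geometric_sum[of x p] by (cases "x = 1") simp_all

text \<open>Orthogonality of the characters of a cyclic group of order \<open>p\<close>: each index
  with \<open>\<eta> i = \<rho>\<close> contributes \<open>p\<close> times its coefficient, and all
  others cancel.\<close>

lemma root_filter:
  fixes c \<eta> :: "'i \<Rightarrow> complex"
  assumes "finite S" "\<And>i. i \<in> S \<Longrightarrow> \<eta> i ^ p = 1" "\<rho> ^ p = 1" "p > 0"
  shows "(\<Sum>t<p. (\<Sum>i\<in>S. c i * \<eta> i ^ t) / \<rho> ^ t) = of_nat p * (\<Sum>i | i \<in> S \<and> \<eta> i = \<rho>. c i)"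
proof -
  have "\<rho> \<noteq> 0" using assms(3,4) by (auto simp: power_0_left)
  have "(\<Sum>t<p. (\<Sum>i\<in>S. c i * \<eta> i ^ t) / \<rho> ^ t) = (\<Sum>i\<in>S. \<Sum>t<p. c i * (\<eta> i / \<rho>) ^ t)"
    by (subst sum.swap) (simp add: sum_divide_distrib power_divide)
  also have "\<dots> = (\<Sum>i\<in>S. c i * (if \<eta> i = \<rho> then of_nat p else 0))"
  proof (rule sum.cong[OF refl])
    fix i assume "i \<in> S"
    then have "(\<eta> i / \<rho>) ^ p = 1" using assms by (simp add: power_divide)
    from sum_powers_root_of_unity[OF this]
    show "(\<Sum>t<p. c i * (\<eta> i / \<rho>) ^ t) = c i * (if \<eta> i = \<rho> then of_nat p else 0)"
      using \<open>\<rho> \<noteq> 0\<close> by (simp flip: sum_distrib_left)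
  qed
  also have "\<dots> = of_nat p * (\<Sum>i | i \<in> S \<and> \<eta> i = \<rho>. c i)"
    using assms(1) by (simp add: sum_distrib_left sum.If_cases Int_def mult.commute if_distrib cong: if_cong)
  finally show ?thesis .
qed

lemma squarefree_dvd_primorial:
  fixes n N :: nat
  assumes "n > 0" "\<And>p. prime p \<Longrightarrow> p dvd n \<Longrightarrow> p \<le> N \<and> \<not> p\<^sup>2 dvd n"
  shows "n dvd \<Prod>{p. prime p \<and> p \<le> N}"
proof -
  have "n = (\<Prod>p\<in>prime_factors n. p ^ multiplicity p n)"
    using assms(1) by (simp add: prod_prime_factors)
  also have "\<dots> = (\<Prod>p\<in>prime_factors n. p)"
  proof (rule prod.cong[OF refl])
    fix p assume "p \<in> prime_factors n"
    then have p: "prime p" "p dvd n" by auto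
    have "multiplicity p n \<ge> 1"
      using p assms(1) by (intro multiplicity_geI) auto
    moreover have "\<not> 2 \<le> multiplicity p n"
      using assms(2)[OF p] by (metis multiplicity_dvd')
    ultimately have "multiplicity p n = 1" by simp
    then show "p ^ multiplicity p n = p" by simp
  qed
  also have "\<dots> dvd \<Prod>{p. prime p \<and> p \<le> N}"
    using assms(2) by (intro prod_dvd_prod_subset) auto
  finally show ?thesis .
qed

text \<open>
  With \<open>R = n / p\<close>, conjugating the relation by \<open>1 + R t\<close> multiplies the \<open>i\<close>-th root by \<open>(\<xi> i ^ R) ^ t\<close>.
  If \<open>p\<^sup>2\<close> divides \<open>n\<close>, all these exponents are coprime to \<open>n\<close>; otherwise all but one are, and the
  exceptional one is handled by a \<open>p\<close>-th root of unity not of the form \<open>\<xi> i ^ R\<close>. Filtering by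
  the value of \<open>\<xi> i ^ R\<close> then yields a proper vanishing subsum.
\<close>

lemma minimal_relation_order_prime:
  fixes a :: "'i \<Rightarrow> rat" and \<xi> :: "'i \<Rightarrow> complex"
  assumes S: "finite S" "i0 \<in> S" "\<xi> i0 = 1"
    and n: "n > 0" "\<And>i. i \<in> S \<Longrightarrow> \<xi> i ^ n = 1"
    and least: "\<And>m. m > 0 \<Longrightarrow> (\<And>i. i \<in> S \<Longrightarrow> \<xi> i ^ m = 1) \<Longrightarrow> n \<le> m"
    and sum0: "(\<Sum>i\<in>S. of_rat (a i) * \<xi> i) = 0"
    and minimal: "\<And>T. T \<subset> S \<Longrightarrow> T \<noteq> {} \<Longrightarrow> (\<Sum>i\<in>T. of_rat (a i) * \<xi> i) \<noteq> 0"
    and p: "prime p" "p dvd n"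
  shows "p \<le> card S \<and> \<not> p\<^sup>2 dvd n"
proof (rule ccontr)
  assume contra: "\<not> (p \<le> card S \<and> \<not> p\<^sup>2 dvd n)"
  obtain R where R: "n = p * R" using p(2) by (elim dvdE)
  have "R > 0" "p > 1" using n(1) R p(1) prime_gt_1_nat by auto
  define \<eta> where "\<eta> = (\<lambda>i. \<xi> i ^ R)"
  have \<eta>: "\<eta> i ^ p = 1" if "i \<in> S" for i
    using n(2)[OF that] by (simp add: \<eta>_def R mult.commute flip: power_mult)
  define b where "b = (\<lambda>t. \<Sum>i\<in>S. of_rat (a i) * \<xi> i * \<eta> i ^ t)"
  have b0: "b t = 0" if "\<not> p dvd 1 + R * t" for t
  proof -
    have "coprime (1 + R * t) R"
    proof (rule coprimeI)
      fix c assume "c dvd 1 + R * t" "c dvd R"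
      then show "is_unit c" by (metis dvd_add_left_iff dvd_mult2)
    qed
    moreover have "coprime (1 + R * t) p"
      using prime_imp_coprime[OF p(1) that] by (simp only: coprime_commute)
    ultimately have "coprime (1 + R * t) n" by (simp add: R)
    from rational_relation_conjugate[OF S(1) n(1) n(2) this sum0]
    show ?thesis by (simp add: b_def \<eta>_def power_add power_mult mult.assoc)
  qed
  have filter: "(\<Sum>t<p. b t / \<rho> ^ t) = of_nat p * (\<Sum>i | i \<in> S \<and> \<eta> i = \<rho>. of_rat (a i) * \<xi> i)"
    if "\<rho> ^ p = 1" for \<rho>
    unfolding b_def using \<open>p > 1\<close> by (intro root_filter S \<eta> that) auto
  have b_zero: "b t0 = 0" if "t0 < p" for t0
  proof (rule ccontr)
    assume nz: "b t0 \<noteq> 0"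
    then have dvd: "p dvd 1 + R * t0" using b0 by blast
    have "\<not> p dvd R"
      using dvd \<open>p > 1\<close> by (metis dvd_add_left_iff dvd_mult2 nat_dvd_1_iff_1 less_irrefl)
    then have "\<not> p\<^sup>2 dvd n" using \<open>p > 1\<close> by (simp add: R power2_eq_square)
    then have "card S < p" using contra by simp
    then have "card (\<eta> ` S) < card {z::complex. z ^ p = 1}"
      using card_image_le[OF S(1), of \<eta>] card_roots_unity_eq[of p] \<open>p > 1\<close> by simp
    then have "\<not> {z. z ^ p = 1} \<subseteq> \<eta> ` S"
      using S(1) by (meson card_mono finite_imageI not_le)
    then obtain \<rho> where \<rho>: "\<rho> ^ p = 1" "\<rho> \<notin> \<eta> ` S" by blast
    have "b t = 0" if "t < p" "t \<noteq> t0" for t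
    proof (rule b0, rule notI)
      assume "p dvd 1 + R * t"
      then have "[1 + R * t = 1 + R * t0] (mod p)" using dvd
        by (metis cong_0_iff cong_sym cong_trans)
      then have "[R * t = R * t0] (mod p)" by (simp only: cong_add_lcancel_nat)
      moreover have "coprime R p"
        using prime_imp_coprime[OF p(1) \<open>\<not> p dvd R\<close>] by (simp only: coprime_commute)
      ultimately have "[t = t0] (mod p)" by (simp add: cong_mult_lcancel_nat)
      then show False using that \<open>t0 < p\<close> cong_less_modulus_unique_nat by blast
    qed
    then have "(\<Sum>t<p. b t / \<rho> ^ t) = (\<Sum>t\<in>{t0}. b t / \<rho> ^ t)"
      using \<open>t0 < p\<close> by (intro sum.mono_neutral_right) auto
    moreover have "{i. i \<in> S \<and> \<eta> i = \<rho>} = {}" using \<rho>(2) by blast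
    ultimately have "b t0 / \<rho> ^ t0 = 0" using filter[OF \<rho>(1)] by simp
    then have "\<rho> = 0" using nz by simp
    then show False using \<rho>(1) \<open>p > 1\<close> by (simp add: power_0_left)
  qed
  define T where "T = {i. i \<in> S \<and> \<eta> i = 1}"
  have "of_nat p * (\<Sum>i\<in>T. of_rat (a i) * \<xi> i) = 0"
    using filter[of 1] b_zero by (simp add: T_def)
  then have "(\<Sum>i\<in>T. of_rat (a i) * \<xi> i) = 0" using \<open>p > 1\<close> by simp
  moreover have "i0 \<in> T" using S by (simp add: T_def \<eta>_def)
  ultimately have "T = S" using minimal[of T] by (auto simp: T_def)
  \<comment> \<open>The filtered subsum being everything means that \<open>R\<close>, which is
    smaller than \<open>n\<close>, is already a common exponent of all the roots.\<close>
  then have "\<xi> i ^ R = 1" if "i \<in> S" for i using that by (auto simp: T_def \<eta>_def)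
  from least[OF \<open>R > 0\<close> this] show False using R \<open>R > 0\<close> \<open>p > 1\<close> by simp
qed

text \<open>Dividing by \<open>\<zeta> j\<close> makes \<open>1\<close> one of the roots. The least
  common exponent of the quotients is squarefree with all prime factors at most \<open>N\<close>,
  and therefore divides the product of these primes.\<close>

theorem mann:
  fixes a :: "'i \<Rightarrow> rat" and \<zeta> :: "'i \<Rightarrow> complex"
  assumes S: "finite S" "card S \<le> N"
    and roots: "\<And>i. i \<in> S \<Longrightarrow> \<exists>q>0. \<zeta> i ^ q = 1"
    and sum0: "(\<Sum>i\<in>S. of_rat (a i) * \<zeta> i) = 0"
    and minimal: "\<And>T. T \<subset> S \<Longrightarrow> T \<noteq> {} \<Longrightarrow> (\<Sum>i\<in>T. of_rat (a i) * \<zeta> i) \<noteq> 0"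
    and ij: "i \<in> S" "j \<in> S"
  shows "\<zeta> i ^ (\<Prod>{p. prime p \<and> p \<le> N}) = \<zeta> j ^ (\<Prod>{p. prime p \<and> p \<le> N})"
proof -
  have nz: "\<zeta> i \<noteq> 0" if "i \<in> S" for i
    using roots[OF that] by (auto simp: power_0_left)
  define \<xi> where "\<xi> = (\<lambda>i. \<zeta> i / \<zeta> j)"
  obtain q where q: "\<And>i. i \<in> S \<Longrightarrow> q i > 0 \<and> \<zeta> i ^ q i = (1::complex)" using roots by metis
  define good where "good = (\<lambda>n::nat. n > 0 \<and> (\<forall>i\<in>S. \<xi> i ^ n = 1))"
  have "good (\<Prod>i\<in>S. q i)"
  proof -
    have "\<zeta> i ^ (\<Prod>i\<in>S. q i) = 1" if "i \<in> S" for i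
      using q[OF that] that S(1) by (metis dvd_prod_eqI dvdE power_mult power_one)
    then have "\<xi> i ^ (\<Prod>i\<in>S. q i) = 1" if "i \<in> S" for i
      using that ij by (simp add: \<xi>_def power_divide)
    moreover have "(\<Prod>i\<in>S. q i) > 0" using q by (intro prod_pos) auto
    ultimately show ?thesis by (simp add: good_def)
  qed
  then have n: "good (Least good)" by (rule LeastI)
  define n where "n = Least good"
  have sub: "(\<Sum>i\<in>T. of_rat (a i) * \<xi> i) = (\<Sum>i\<in>T. of_rat (a i) * \<zeta> i) / \<zeta> j" for T
    by (simp add: \<xi>_def sum_divide_distrib)
  have prime: "p \<le> N \<and> \<not> p\<^sup>2 dvd n" if p: "prime p" "p dvd n" for p
  proof -
    have "p \<le> card S \<and> \<not> p\<^sup>2 dvd n"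
    proof (rule minimal_relation_order_prime[OF S(1) ij(2) _ _ _ _ _ _ p])
      show "\<xi> j = 1" using nz[OF ij(2)] by (simp add: \<xi>_def)
      show "n > 0" "\<And>i. i \<in> S \<Longrightarrow> \<xi> i ^ n = 1" using n by (auto simp: good_def n_def)
      show "n \<le> m" if "m > 0" "\<And>i. i \<in> S \<Longrightarrow> \<xi> i ^ m = 1" for m
        unfolding n_def using that by (intro Least_le) (auto simp: good_def)
      show "(\<Sum>i\<in>S. of_rat (a i) * \<xi> i) = 0" by (simp add: sub sum0)
      show "(\<Sum>i\<in>T. of_rat (a i) * \<xi> i) \<noteq> 0" if "T \<subset> S" "T \<noteq> {}" for T
        using minimal[OF that] nz[OF ij(2)] by (simp add: sub)
    qed
    then show ?thesis using S(2) by linarith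
  qed
  have "n > 0" using n by (simp add: n_def good_def)
  then have "n dvd \<Prod>{p. prime p \<and> p \<le> N}"
    using prime by (rule squarefree_dvd_primorial)
  then obtain k where k: "\<Prod>{p. prime p \<and> p \<le> N} = n * k" by (elim dvdE)
  have "\<xi> i ^ n = 1" using n ij(1) by (simp add: n_def good_def)
  then have "\<xi> i ^ \<Prod>{p. prime p \<and> p \<le> N} = 1" by (simp only: k power_mult power_one)
  then show ?thesis using nz ij by (simp add: \<xi>_def power_divide)
qed

section \<open>Monomials, adjugates and subtori\<close>

abbreviation real_vec :: "int ^ 'n \<Rightarrow> real ^ 'n" where
  "real_vec v \<equiv> (\<chi> i. real_of_int (v $ i))"

text \<open>The character of the torus with exponent vector \<open>m\<close>. Negative exponents
  arise because annihilators are formed from differences of exponent vectors.\<close>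

definition monomial :: "complex ^ 'n::finite \<Rightarrow> int ^ 'n \<Rightarrow> complex" where
  "monomial x m = (\<Prod>i\<in>UNIV. (x $ i) powi (m $ i))"

lemma monomial_diff:
  assumes "\<And>i. x $ i \<noteq> 0"
  shows "monomial x (a - b) = monomial x a / monomial x b"
  using assms by (simp add: monomial_def power_int_diff prod_dividef)

lemma monomial_mult: "monomial (x * y) m = monomial x m * monomial y m"
  by (simp add: monomial_def power_int_mult_distrib prod.distrib)

lemma monomial_nonzero:
  assumes "\<And>i. x $ i \<noteq> 0"
  shows "monomial x m \<noteq> 0"
  using assms by (simp add: monomial_def)

lemma monomial_one [simp]: "monomial 1 m = 1"
  by (simp add: monomial_def)

lemma monomial_power: "monomial (\<chi> i. x $ i ^ n) m = monomial x m ^ n"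
proof -
  have "(z ^ n) powi k = (z powi k) ^ n" for z :: complex and k
    by (simp add: mult.commute flip: power_int_mult power_int_of_nat)
  then show ?thesis by (simp add: monomial_def prod_power_distrib)
qed

lemma power_int_sum:
  assumes "(z::complex) \<noteq> 0"
  shows "z powi (\<Sum>i\<in>A. f i) = (\<Prod>i\<in>A. z powi (f i))"
  by (induction A rule: infinite_finite_induct) (simp_all add: power_int_add assms)

lemma power_int_prod:
  "(\<Prod>i\<in>A. (f i :: complex)) powi m = (\<Prod>i\<in>A. f i powi m)"
  by (induction A rule: infinite_finite_induct) (simp_all add: power_int_mult_distrib)

lemma monomial_parametrised:
  assumes "\<And>j. j \<in> K \<Longrightarrow> t j \<noteq> 0"
  shows "monomial (\<chi> i. \<Prod>j\<in>K. t j powi (c j $ i)) m = (\<Prod>j\<in>K. t j powi (\<Sum>i\<in>UNIV. c j $ i * m $ i))"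
proof -
  have "monomial (\<chi> i. \<Prod>j\<in>K. t j powi (c j $ i)) m =
      (\<Prod>i\<in>UNIV. \<Prod>j\<in>K. t j powi (c j $ i * m $ i))"
    by (simp add: monomial_def power_int_prod power_int_mult)
  also have "\<dots> = (\<Prod>j\<in>K. \<Prod>i\<in>UNIV. t j powi (c j $ i * m $ i))"
    by (rule prod.swap)
  also have "\<dots> = (\<Prod>j\<in>K. t j powi (\<Sum>i\<in>UNIV. c j $ i * m $ i))"
    using assms by (intro prod.cong refl) (simp add: power_int_sum)
  finally show ?thesis .
qed

section \<open>Integer adjugates and determinant bounds\<close>

lemma of_int_det:
  "of_int (det (A :: int ^ 'n ^ 'n)) = det (\<chi> i j. of_int (A $ i $ j) :: 'a::comm_ring_1 ^ 'n ^ 'n)"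
  by (simp add: det_def)

text \<open>Cramer's rule: the entry \<open>C $ k $ l\<close> is the determinant of \<open>A\<close>
  with column \<open>k\<close> replaced by the \<open>l\<close>-th unit vector, so it is an integer
  by construction. Over the reals it is \<open>det A\<close> times the entry of the inverse, which
  gives both identities.\<close>

lemma int_adjugate:
  fixes A :: "int ^ 'n ^ 'n"
  assumes "det A \<noteq> 0"
  obtains C where "A ** C = mat (det A)" "C ** A = mat (det A)"
proof -
  define A' :: "real ^ 'n ^ 'n" where "A' = (\<chi> i j. of_int (A $ i $ j))"
  have det: "det A' = of_int (det A)" by (simp add: A'_def of_int_det)
  then have "invertible A'" using assms by (simp add: invertible_det_nz)
  then obtain X where X: "A' ** X = mat 1" "X ** A' = mat 1"
    by (auto simp: invertible_def)
  define C :: "int ^ 'n ^ 'n" where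
    "C = (\<chi> k l. det (\<chi> i j. if j = k then (if i = l then 1 else 0) else A $ i $ j))"
  have C: "of_int (C $ k $ l) = X $ k $ l * of_int (det A)" for k l
  proof -
    have col: "A' *v (column l X) = axis l 1"
    proof -
      have "(A' *v column l X) $ i = (A' ** X) $ i $ l" for i
        by (simp add: matrix_vector_mult_def matrix_matrix_mult_def column_def)
      then show ?thesis by (simp add: vec_eq_iff X mat_def axis_def)
    qed
    have "of_int (C $ k $ l) =
        det (\<chi> i j. if j = k then (A' *v (column l X)) $ i else A' $ i $ j :: real ^ 'n ^ 'n)"
      unfolding col C_def vec_lambda_beta of_int_det
      by (intro arg_cong[of _ _ det]) (simp add: vec_eq_iff A'_def axis_def)
    also have "\<dots> = column l X $ k * det A'" by (rule cramer_lemma)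
    finally show ?thesis by (simp add: det column_def)
  qed
  have 1: "(A ** C) $ i $ j = mat (det A) $ i $ j" for i j
  proof -
    have "real_of_int ((A ** C) $ i $ j) = (A' ** X) $ i $ j * of_int (det A)"
      by (simp add: matrix_matrix_mult_def C A'_def sum_distrib_right mult.assoc)
    also have "\<dots> = real_of_int (mat (det A) $ i $ j)" by (simp add: X mat_def)
    finally show ?thesis by linarith
  qed
  have 2: "(C ** A) $ i $ j = mat (det A) $ i $ j" for i j
  proof -
    have "real_of_int ((C ** A) $ i $ j) = (X ** A') $ i $ j * of_int (det A)"
      by (simp add: matrix_matrix_mult_def C A'_def sum_distrib_left mult_ac)
    also have "\<dots> = real_of_int (mat (det A) $ i $ j)" by (simp add: X mat_def)
    finally show ?thesis by linarith
  qed
  show thesis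
    by (rule that[of C]) (use 1 2 in \<open>simp_all add: vec_eq_iff\<close>)
qed

text \<open>Expanding the product of row sums gives one term for every function from rows to
  columns; the Leibniz formula uses only the permutations among them.\<close>

lemma abs_det_le_prod_row_sums:
  fixes A :: "'a::linordered_idom ^ 'n ^ 'n"
  shows "\<bar>det A\<bar> \<le> (\<Prod>i\<in>UNIV. \<Sum>j\<in>UNIV. \<bar>A $ i $ j\<bar>)"
proof -
  have "\<bar>det A\<bar> \<le> (\<Sum>p | p permutes (UNIV :: 'n set). \<bar>of_int (sign p) * (\<Prod>i\<in>UNIV. A $ i $ p i)\<bar>)"
    unfolding det_def by (rule sum_abs)
  also have "\<dots> = (\<Sum>p | p permutes (UNIV :: 'n set). \<Prod>i\<in>UNIV. \<bar>A $ i $ p i\<bar>)"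
  proof (rule sum.cong[OF refl])
    fix p :: "'n \<Rightarrow> 'n"
    have "\<bar>of_int (sign p)\<bar> = (1::'a)" by (simp add: sign_def)
    then show "\<bar>of_int (sign p) * (\<Prod>i\<in>UNIV. A $ i $ p i)\<bar> = (\<Prod>i\<in>UNIV. \<bar>A $ i $ p i\<bar>)"
      by (simp add: abs_mult abs_prod)
  qed
  also have "\<dots> \<le> (\<Sum>p\<in>PiE UNIV (\<lambda>_. UNIV). \<Prod>i\<in>UNIV. \<bar>A $ i $ p i\<bar>)"
    by (intro sum_mono2 finite_PiE prod_nonneg) auto
  also have "\<dots> = (\<Prod>i\<in>UNIV. \<Sum>j\<in>UNIV. \<bar>A $ i $ j\<bar>)"
    by (rule prod_sum_PiE[symmetric]) auto
  finally show ?thesis .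
qed

text \<open>Extend a basis of the span of \<open>M\<close>, chosen inside \<open>M\<close>, by
  standard unit vectors. Each unit vector is placed in the row of its own index, so that the rows in
  \<open>K\<close> of a matrix \<open>C\<close> with \<open>A ** C = mat (det A)\<close> can be read
  off directly.\<close>

lemma extend_by_axes:
  fixes M :: "(int ^ 'n) set"
  obtains K :: "'n set" and A :: "int ^ 'n ^ 'n" where
    "\<And>j. j \<in> K \<Longrightarrow> A $ j = axis j 1" "\<And>j. j \<notin> K \<Longrightarrow> A $ j \<in> M" "det A \<noteq> 0"
    "real_vec ` M \<subseteq> span ((\<lambda>j. real_vec (A $ j)) ` (- K))"
proof -
  obtain Bm where Bm: "Bm \<subseteq> real_vec ` M" "independent Bm" "real_vec ` M \<subseteq> span Bm"
    using maximal_independent_subset by blast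
  obtain B where B: "Bm \<subseteq> B" "B \<subseteq> Bm \<union> Basis" "independent B" "Bm \<union> Basis \<subseteq> span B"
    using maximal_independent_subset_extend[of Bm "Bm \<union> (Basis :: (real ^ 'n) set)"] Bm(2) by blast
  have span: "span B = UNIV"
    using B(4) span_mono[of Basis "span B"] by (auto simp: span_span)
  then have card_B: "card B = CARD('n)"
    using B(3) by (metis dim_eq_card_independent dim_span dim_UNIV DIM_cart DIM_real mult.right_neutral)
  have "finite B" using B(3) by (rule independent_imp_finite)
  \<comment> \<open>The indices of the unit vectors added to \<open>Bm\<close>. Counting leaves
    exactly \<open>card Bm\<close> further rows, which any bijection \<open>g\<close> may fill with
    the elements of \<open>Bm\<close>.\<close>
  define K where "K = {j :: 'n. axis j 1 \<in> B - Bm}"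
  have image_K: "(\<lambda>j. axis j (1::real)) ` K = B - Bm"
    using B(2) by (auto simp: K_def Basis_vec_def)
  have "card K = card (B - Bm)"
    unfolding image_K[symmetric] by (rule card_image[symmetric]) (auto simp: inj_on_def axis_eq_axis)
  moreover have "card (B - Bm) = card B - card Bm"
    using B(1) \<open>finite B\<close> by (meson card_Diff_subset finite_subset)
  moreover have "card Bm \<le> card B" using B(1) \<open>finite B\<close> by (rule card_mono[rotated])
  ultimately have "card (- K) = card Bm"
    by (simp add: card_B Compl_eq_Diff_UNIV card_Diff_subset)
  moreover have "finite Bm" using B(1) \<open>finite B\<close> finite_subset by blast
  ultimately obtain g where g: "bij_betw g (- K) Bm"
    by (metis finite_same_card_bij finite)
  have "\<exists>m\<in>M. g j = real_vec m" if "j \<notin> K" for j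
    using g that Bm(1) by (auto simp: bij_betw_def)
  then obtain h where h: "\<And>j. j \<notin> K \<Longrightarrow> h j \<in> M \<and> g j = real_vec (h j)" by metis
  define A :: "int ^ 'n ^ 'n" where "A = (\<chi> j. if j \<in> K then axis j 1 else h j)"
  have rv: "real_vec (A $ j) = (if j \<in> K then axis j 1 else g j)" for j
    using h by (auto simp: A_def vec_eq_iff axis_def)
  have image_g: "(\<lambda>j. real_vec (A $ j)) ` (- K) = Bm"
    using g by (auto simp: rv bij_betw_def)
  have "det A \<noteq> 0"
  proof -
    define A' :: "real ^ 'n ^ 'n" where "A' = (\<chi> i j. of_int (A $ i $ j))"
    have row: "row j A' = real_vec (A $ j)" for j by (simp add: A'_def row_def)
    have "rows A' = (\<lambda>j. real_vec (A $ j)) ` (K \<union> - K)"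
      by (auto simp: rows_def row)
    also have "\<dots> = B"
      using image_g image_K B(1) by (auto simp: image_Un rv)
    finally have "\<exists>X. X ** A' = mat 1"
      using span by (simp add: matrix_left_invertible_span_rows)
    then have "det A' \<noteq> 0"
      by (metis invertible_det_nz invertible_left_inverse)
    then show ?thesis by (simp add: A'_def flip: of_int_det)
  qed
  show ?thesis
  proof (rule that[of K A])
    show "A $ j = axis j 1" if "j \<in> K" for j using that by (simp add: A_def)
    show "A $ j \<in> M" if "j \<notin> K" for j using that h by (simp add: A_def)
    show "real_vec ` M \<subseteq> span ((\<lambda>j. real_vec (A $ j)) ` (- K))"
      using Bm(3) unfolding image_g .
  qed fact
qed

text \<open>The columns indexed by \<open>K\<close>, restricted to the coordinates in
  \<open>K\<close>, form a nonzero multiple of the identity and so are independent. The rest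
  renumbers \<open>K\<close> by \<open>{1..card K}\<close> to match the form of
  \<open>subtorus\<close>.\<close>

lemma subtorus_from_scaled_axes:
  fixes C :: "int ^ 'n ^ 'n"
  assumes "\<Delta> \<noteq> 0" "\<And>i j. i \<in> K \<Longrightarrow> j \<in> K \<Longrightarrow> C $ i $ j = (if i = j then \<Delta> else 0)"
  shows "subtorus (card K) {x. \<exists>t. (\<forall>j\<in>K. t j \<noteq> 0) \<and> (\<forall>i. x $ i = (\<Prod>j\<in>K. t j powi (C $ i $ j)))}"
proof -
  obtain b where b: "bij_betw b {1..card K} K"
    by (metis finite ex_bij_betw_nat_finite_1)
  define E where "E = (\<lambda>l. column (b l) C)"
  have col: "real_vec (column j C) $ i = real_of_int (C $ i $ j)" for i j
    by (simp add: column_def)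
  have inj: "inj_on (\<lambda>j. real_vec (column j C)) K"
  proof (rule inj_onI)
    fix i j assume ij: "i \<in> K" "j \<in> K" "real_vec (column i C) = real_vec (column j C)"
    then have "C $ i $ i = C $ i $ j" by (metis col of_int_eq_iff)
    then show "i = j" using assms ij by (auto split: if_splits)
  qed
  have "independent ((\<lambda>j. real_vec (column j C)) ` K)"
  proof (rule independent_if_scalars_zero)
    fix f x assume s: "(\<Sum>x\<in>(\<lambda>j. real_vec (column j C)) ` K. f x *\<^sub>R x) = 0"
      and "x \<in> (\<lambda>j. real_vec (column j C)) ` K"
    then obtain i where i: "i \<in> K" "x = real_vec (column i C)" by blast
    have "0 = (\<Sum>j\<in>K. f (real_vec (column j C)) *\<^sub>R real_vec (column j C)) $ i"
      using s by (simp add: sum.reindex[OF inj])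
    also have "\<dots> = (\<Sum>j\<in>K. f (real_vec (column j C)) * real_of_int (C $ i $ j))"
      by (simp add: column_def)
    also have "\<dots> = (\<Sum>j\<in>K. if i = j then f x * real_of_int \<Delta> else 0)"
    proof (rule sum.cong[OF refl])
      fix j assume "j \<in> K"
      from assms(2)[OF i(1) this]
      show "f (real_vec (column j C)) * real_of_int (C $ i $ j) = (if i = j then f x * real_of_int \<Delta> else 0)"
        by (cases "i = j") (simp_all only: i(2) if_True if_False of_int_0 mult_zero_right simp_thms)
    qed
    also have "\<dots> = f x * of_int \<Delta>" using i(1) by simp
    finally show "f x = 0" using assms(1) by simp
  qed simp
  then have "dim ((\<lambda>j. real_vec (column j C)) ` K) = card K"
    using inj by (metis dim_eq_card_independent card_image)
  moreover have "(\<lambda>l. real_vec (E l)) ` {1..card K} = (\<lambda>j. real_vec (column j C)) ` (b ` {1..card K})"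
    unfolding E_def by (simp only: image_image)
  then have "(\<lambda>l. real_vec (E l)) ` {1..card K} = (\<lambda>j. real_vec (column j C)) ` K"
    unfolding bij_betw_imp_surj_on[OF b] .
  ultimately have dim: "dim ((\<lambda>l. real_vec (E l)) ` {1..card K}) = card K" by simp
  have E: "E l $ i = C $ i $ b l" for l i by (simp add: E_def column_def)
  have "{x. \<exists>t. (\<forall>j\<in>K. t j \<noteq> 0) \<and> (\<forall>i. x $ i = (\<Prod>j\<in>K. t j powi (C $ i $ j)))} =
    {x. \<exists>t :: nat \<Rightarrow> complex. (\<forall>l\<in>{1..card K}. t l \<noteq> 0) \<and>
       (\<forall>i. x $ i = (\<Prod>l\<in>{1..card K}. t l powi (E l $ i)))}" (is "?A = ?B")
  proof (intro equalityI subsetI)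
    fix x assume "x \<in> ?A"
    then obtain t where t: "\<forall>j\<in>K. t j \<noteq> 0" "\<forall>i. x $ i = (\<Prod>j\<in>K. t j powi (C $ i $ j))" by blast
    have "x $ i = (\<Prod>l\<in>{1..card K}. (t \<circ> b) l powi (E l $ i))" for i
      using t(2) prod.reindex_bij_betw[OF b, of "\<lambda>j. t j powi (C $ i $ j)"]
      by (simp add: E del: One_nat_def)
    moreover have "\<forall>l\<in>{1..card K}. (t \<circ> b) l \<noteq> 0" using t(1) bij_betwE[OF b] by (simp del: One_nat_def)
    ultimately show "x \<in> ?B" by blast
  next
    fix x assume "x \<in> ?B"
    then obtain t where t: "\<forall>l\<in>{1..card K}. t l \<noteq> 0"
      "\<forall>i. x $ i = (\<Prod>l\<in>{1..card K}. t l powi (E l $ i))" by blast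
    define b' where "b' = the_inv_into {1..card K} b"
    have b': "b' (b l) = l" if "l \<in> {1..card K}" for l
      using b that by (simp add: b'_def bij_betw_def the_inv_into_f_f)
    have "x $ i = (\<Prod>j\<in>K. (t \<circ> b') j powi (C $ i $ j))" for i
      using t(2) b' prod.reindex_bij_betw[OF b, of "\<lambda>j. t (b' j) powi (C $ i $ j)"]
      by (simp add: E del: One_nat_def)
    moreover have "\<forall>j\<in>b ` {1..card K}. (t \<circ> b') j \<noteq> 0" using t(1) b' by simp
    then have "\<forall>j\<in>K. (t \<circ> b') j \<noteq> 0" unfolding bij_betw_imp_surj_on[OF b] .
    ultimately show "x \<in> ?A" by blast
  qed
  then show ?thesis using dim unfolding subtorus_def by blast
qed

lemma abs_le_square_int: "\<bar>a\<bar> \<le> a\<^sup>2" for a :: int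
proof (cases "a = 0")
  case False
  then have "\<bar>a\<bar> \<le> \<bar>a\<bar> ^ 2" by (intro self_le_power) auto
  then show ?thesis by simp
qed simp

lemma annihilator_subtorus:
  fixes M :: "(int ^ 'n) set"
  assumes bound: "\<And>m. m \<in> M \<Longrightarrow> norm (real_vec m) \<le> D"
  obtains H :: "(complex ^ 'n) set" and k e :: nat where
    "k \<le> CARD('n)" "subtorus (CARD('n) - k) H" "e > 0" "real e \<le> D ^ (2 * k)"
    "\<forall>x\<in>H. \<forall>m\<in>M. monomial x m = 1"
    "\<forall>x. (\<forall>i. x $ i \<noteq> 0) \<and> (\<forall>m\<in>M. monomial x m = 1) \<longrightarrow> (\<chi> i. x $ i ^ e) \<in> H"
proof -
  obtain K A where A: "\<And>j. j \<in> K \<Longrightarrow> A $ j = axis j 1" "\<And>j. j \<notin> K \<Longrightarrow> A $ j \<in> M" "det A \<noteq> 0"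
    "real_vec ` M \<subseteq> span ((\<lambda>j. real_vec (A $ j)) ` (- K))"
    using extend_by_axes[of M] by blast
  obtain C where C: "A ** C = mat (det A)" "C ** A = mat (det A)"
    using int_adjugate[OF A(3)] by blast
  have AC: "(\<Sum>l\<in>UNIV. A $ i $ l * C $ l $ j) = (if i = j then det A else 0)" for i j
    using C(1) by (simp add: vec_eq_iff matrix_matrix_mult_def mat_def)
  have CA: "(\<Sum>l\<in>UNIV. C $ i $ l * A $ l $ j) = (if i = j then det A else 0)" for i j
    using C(2) by (simp add: vec_eq_iff matrix_matrix_mult_def mat_def)
  define H :: "(complex ^ 'n) set" where "H = {x. \<exists>t. (\<forall>j\<in>K. t j \<noteq> 0) \<and> (\<forall>i. x $ i = (\<Prod>j\<in>K. t j powi (C $ i $ j)))}"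
  define k where "k = card (- K)"
  define e where "e = nat \<bar>det A\<bar>"
  have k: "k \<le> CARD('n)" "CARD('n) - k = card K"
    by (simp_all add: k_def Compl_eq_Diff_UNIV card_Diff_subset card_mono)
  have "C $ i $ j = (if i = j then det A else 0)" if "i \<in> K" for i j
    using AC[of i j] A(1)[OF that] by (simp add: axis_def if_distrib[of "\<lambda>x. x * _"] cong: if_cong)
  then have sub: "subtorus (CARD('n) - k) H"
    unfolding H_def k(2) using A(3) by (intro subtorus_from_scaled_axes[of "det A"]) auto
  \<comment> \<open>A column of \<open>C\<close> with index in \<open>K\<close> is orthogonal to
    every row of \<open>A\<close> outside \<open>K\<close>, and these rows span \<open>M\<close>
    over the reals.\<close>
  have orth: "(\<Sum>i\<in>UNIV. C $ i $ j * m $ i) = 0" if "j \<in> K" "m \<in> M" for j m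
  proof -
    have "orthogonal (real_vec (column j C)) (real_vec m)"
    proof (rule orthogonal_to_span)
      show "real_vec m \<in> span ((\<lambda>j. real_vec (A $ j)) ` (- K))" using A(4) that(2) by blast
      fix y assume "y \<in> (\<lambda>j. real_vec (A $ j)) ` (- K)"
      then obtain l where l: "l \<notin> K" "y = real_vec (A $ l)" by blast
      have "real_vec (column j C) \<bullet> y = real_of_int (\<Sum>i\<in>UNIV. A $ l $ i * C $ i $ j)"
        by (simp add: l inner_vec_def column_def mult.commute)
      also have "\<dots> = 0" using l that(1) by (auto simp: AC)
      finally show "orthogonal (real_vec (column j C)) y" by (simp add: orthogonal_def)
    qed
    then have "real_of_int (\<Sum>i\<in>UNIV. C $ i $ j * m $ i) = 0"
      by (simp add: orthogonal_def inner_vec_def column_def)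
    then show ?thesis by linarith
  qed
  have "e > 0" using A(3) by (simp add: e_def)
  have row_bound: "real_of_int (\<Sum>i\<in>UNIV. \<bar>A $ j $ i\<bar>) \<le> (if j \<in> K then 1 else D\<^sup>2)" for j
  proof (cases "j \<in> K")
    case True
    then show ?thesis by (simp add: A(1) axis_def if_distrib[of abs] cong: if_cong)
  next
    case False
    have "(\<Sum>i\<in>UNIV. \<bar>A $ j $ i\<bar>) \<le> (\<Sum>i\<in>UNIV. (A $ j $ i)\<^sup>2)"
      by (intro sum_mono) (rule abs_le_square_int)
    then have "real_of_int (\<Sum>i\<in>UNIV. \<bar>A $ j $ i\<bar>) \<le> (norm (real_vec (A $ j)))\<^sup>2"
      by (simp add: norm_vec_def L2_set_def sum_nonneg flip: of_int_power of_int_sum)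
    also have "\<dots> \<le> D\<^sup>2" using bound[OF A(2)[OF False]] by (intro power_mono) auto
    finally show ?thesis using False by simp
  qed
  have "real e = real_of_int \<bar>det A\<bar>" by (simp add: e_def)
  also have "\<dots> \<le> real_of_int (\<Prod>j\<in>UNIV. \<Sum>i\<in>UNIV. \<bar>A $ j $ i\<bar>)"
    unfolding of_int_le_iff by (rule abs_det_le_prod_row_sums)
  also have "\<dots> \<le> (\<Prod>j\<in>UNIV. if j \<in> K then 1 else D\<^sup>2)"
    unfolding of_int_prod using row_bound by (intro prod_mono) (auto simp: sum_nonneg)
  also have "\<dots> = D ^ (2 * k)"
    by (simp add: prod.If_cases k_def power_mult)
  finally have e_le: "real e \<le> D ^ (2 * k)" .
  have mon: "monomial x m = 1" if "x \<in> H" "m \<in> M" for x m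
  proof -
    obtain t where t: "\<forall>j\<in>K. t j \<noteq> 0" "\<forall>i. x $ i = (\<Prod>j\<in>K. t j powi (C $ i $ j))"
      using \<open>x \<in> H\<close> by (auto simp: H_def)
    then have "x = (\<chi> i. \<Prod>j\<in>K. t j powi (column j C $ i))"
      by (simp add: vec_eq_iff column_def)
    then show ?thesis
      using monomial_parametrised[of K t "\<lambda>j. column j C" m] t(1) orth[OF _ that(2)]
      by (simp add: column_def)
  qed
  have pow: "(\<chi> i. x $ i ^ e) \<in> H"
    if nz: "\<And>i. x $ i \<noteq> 0" and x: "\<And>m. m \<in> M \<Longrightarrow> monomial x m = 1" for x
  proof -
    \<comment> \<open>These values are the parameters that exhibit the power of \<open>x\<close> as
      a point of \<open>H\<close>. Since \<open>y j = 1\<close> outside \<open>K\<close>, the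
      product may run over all rows, where the identity \<open>CA\<close> applies; the exponent
      \<open>sgn (det A)\<close> turns \<open>det A\<close> into its absolute value.\<close>
    define y where "y = (\<lambda>j. monomial x (A $ j))"
    have y: "y j \<noteq> 0" "j \<notin> K \<Longrightarrow> y j = 1" for j
      using A(2) x monomial_nonzero[OF nz] by (auto simp: y_def)
    have "(\<Prod>j\<in>K. (y j powi sgn (det A)) powi (C $ i $ j)) = x $ i ^ e" for i
    proof -
      have "(\<Prod>j\<in>K. (y j powi sgn (det A)) powi (C $ i $ j)) =
          (\<Prod>j\<in>K. y j powi (C $ i $ j * sgn (det A)))"
        by (simp add: mult.commute flip: power_int_mult)
      also have "\<dots> = (\<Prod>j\<in>UNIV. y j powi (C $ i $ j * sgn (det A)))"
        using y(2) by (intro prod.mono_neutral_left) auto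
      also have "\<dots> = (\<Prod>j\<in>UNIV. \<Prod>l\<in>UNIV. (x $ l) powi (A $ j $ l * (C $ i $ j * sgn (det A))))"
        by (simp add: y_def monomial_def power_int_prod power_int_mult)
      also have "\<dots> = (\<Prod>l\<in>UNIV. \<Prod>j\<in>UNIV. (x $ l) powi (C $ i $ j * A $ j $ l * sgn (det A)))"
        by (subst prod.swap) (simp add: mult_ac)
      also have "\<dots> = (\<Prod>l\<in>UNIV. (x $ l) powi ((\<Sum>j\<in>UNIV. C $ i $ j * A $ j $ l) * sgn (det A)))"
        using nz by (simp add: power_int_sum sum_distrib_right)
      also have "\<dots> = (\<Prod>l\<in>UNIV. if i = l then (x $ l) powi \<bar>det A\<bar> else 1)"
        by (intro prod.cong refl) (simp add: CA abs_sgn)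
      also have "\<dots> = x $ i ^ e" by (simp add: e_def flip: power_int_of_nat)
      finally show ?thesis .
    qed
    then show ?thesis
      unfolding H_def using y(1)
      by (auto intro!: exI[of _ "\<lambda>j. y j powi sgn (det A)"])
  qed
  show thesis
    by (rule that[OF k(1) sub \<open>e > 0\<close> e_le]) (use mon pow in blast)+
qed

section \<open>Logarithmic images and roots in subtori\<close>

lemma ln_powi:
  assumes "x > 0"
  shows "ln (x powi k) = of_int k * ln (x::real)"
  using assms by (simp add: ln_powr flip: powr_real_of_int')

text \<open>Shows that the dimension of a subtorus depends only on the underlying set.\<close>

lemma dim_log_subtorus:
  fixes H :: "(complex ^ 'n::finite) set"
  assumes "subtorus r H"
  shows "dim ((\<lambda>x. (\<chi> i. ln (norm (x $ i))) :: real ^ 'n) ` H) = r"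
proof -
  obtain E :: "nat \<Rightarrow> int ^ 'n" where dim: "dim ((\<lambda>j. real_vec (E j)) ` {1..r}) = r"
    and H: "H = {x. \<exists>t :: nat \<Rightarrow> complex. (\<forall>j\<in>{1..r}. t j \<noteq> 0) \<and>
                 (\<forall>i. x $ i = (\<Prod>j\<in>{1..r}. t j powi (E j $ i)))}"
    using assms unfolding subtorus_def by blast
  define R where "R = (\<lambda>j. real_vec (E j)) ` {1..r}"
  define \<Lambda> where "\<Lambda> = (\<lambda>x :: complex ^ 'n. (\<chi> i. ln (norm (x $ i))) :: real ^ 'n)"
  have log: "\<Lambda> x = (\<Sum>j\<in>{1..r}. ln (norm (t j)) *\<^sub>R real_vec (E j))"
    if "\<forall>j\<in>{1..r}. t j \<noteq> 0" "\<forall>i. x $ i = (\<Prod>j\<in>{1..r}. t j powi (E j $ i))" for x t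
  proof -
    have "ln (norm (x $ i)) = (\<Sum>j\<in>{1..r}. ln (norm (t j)) * real_of_int (E j $ i))" for i
    proof -
      have "ln (norm (x $ i)) = ln (\<Prod>j\<in>{1..r}. norm (t j) powi (E j $ i))"
        using that(2) by (simp only: prod_norm[symmetric] norm_power_int)
      also have "\<dots> = (\<Sum>j\<in>{1..r}. ln (norm (t j) powi (E j $ i)))"
        using that(1) by (intro ln_prod) auto
      also have "\<dots> = (\<Sum>j\<in>{1..r}. ln (norm (t j)) * real_of_int (E j $ i))"
        using that(1) by (intro sum.cong refl) (simp add: ln_powi)
      finally show ?thesis .
    qed
    then show ?thesis by (simp add: vec_eq_iff \<Lambda>_def del: One_nat_def)
  qed
  \<comment> \<open>The logarithmic image of \<open>H\<close> lies between the set \<open>R\<close>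
    of rows and its span; this alone determines its dimension.\<close>
  have "\<Lambda> ` H \<subseteq> span R"
  proof
    fix v assume "v \<in> \<Lambda> ` H"
    then obtain x t where "v = \<Lambda> x" "\<forall>j\<in>{1..r}. t j \<noteq> 0"
      "\<forall>i. x $ i = (\<Prod>j\<in>{1..r}. t j powi (E j $ i))" by (auto simp: H)
    then have "v = (\<Sum>j\<in>{1..r}. ln (norm (t j)) *\<^sub>R real_vec (E j))"
      using log by blast
    moreover have "real_vec (E j) \<in> span R" if "j \<in> {1..r}" for j
      using that by (intro span_base) (auto simp: R_def)
    then have "(\<Sum>j\<in>{1..r}. ln (norm (t j)) *\<^sub>R real_vec (E j)) \<in> span R"
      by (intro span_sum span_scale)
    ultimately show "v \<in> span R" by (simp only:)
  qed
  moreover have "R \<subseteq> \<Lambda> ` H"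
  proof
    fix v assume "v \<in> R"
    then obtain l where l: "l \<in> {1..r}" "v = real_vec (E l)" by (auto simp: R_def)
    \<comment> \<open>The logarithm of the absolute value is \<open>1\<close> at \<open>l\<close>
      and \<open>0\<close> elsewhere, so the point with these parameters is mapped to the
      \<open>l\<close>-th row.\<close>
    define t where "t = (\<lambda>j. if j = l then exp 1 else (1::complex))"
    define x :: "complex ^ 'n" where "x = (\<chi> i. \<Prod>j\<in>{1..r}. t j powi (E j $ i))"
    have t: "\<forall>j\<in>{1..r}. t j \<noteq> 0" "\<forall>i. x $ i = (\<Prod>j\<in>{1..r}. t j powi (E j $ i))"
      by (auto simp: t_def x_def)
    then have "x \<in> H" by (auto simp: H)
    moreover have "\<Lambda> x = (\<Sum>j\<in>{1..r}. if j = l then v else 0)"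
      unfolding log[OF t] by (intro sum.cong) (auto simp: t_def l)
    ultimately show "v \<in> \<Lambda> ` H" using l(1) by auto
  qed
  ultimately have "dim R = dim (\<Lambda> ` H)"
    by (metis dim_mono span_span dim_span order_antisym dim_subset)
  then show ?thesis using dim by (simp add: R_def \<Lambda>_def)
qed

text \<open>Subtori are divisible groups: take \<open>e\<close>-th roots of the parameters by means
  of the complex logarithm. This removes the exponent \<open>e\<close> when a subtorus is to be
  included in an annihilator subtorus.\<close>

lemma subtorus_root:
  fixes H :: "(complex ^ 'n::finite) set"
  assumes "subtorus r H" "x \<in> H" "e > 0"
  obtains y where "y \<in> H" "x = (\<chi> i. y $ i ^ e)"
proof -
  obtain E :: "nat \<Rightarrow> int ^ 'n" where 
    H: "H = {x. \<exists>t :: nat \<Rightarrow> complex. (\<forall>j\<in>{1..r}. t j \<noteq> 0) \<and>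
                 (\<forall>i. x $ i = (\<Prod>j\<in>{1..r}. t j powi (E j $ i)))}"
    using assms(1) unfolding subtorus_def by blast
  obtain t where t: "\<forall>j\<in>{1..r}. t j \<noteq> 0" "\<forall>i. x $ i = (\<Prod>j\<in>{1..r}. t j powi (E j $ i))"
    using assms(2) H by blast
  define s where "s = (\<lambda>j. exp (Ln (t j) / of_nat e))"
  have s: "t j = s j ^ e" if "j \<in> {1..r}" for j
    using t(1) that assms(3) by (simp add: s_def flip: exp_of_nat_mult)
  define y :: "complex ^ 'n" where "y = (\<chi> i. \<Prod>j\<in>{1..r}. s j powi (E j $ i))"
  have "y \<in> H" unfolding H by (auto simp: y_def s_def intro!: exI[of _ s])
  moreover have "x $ i = y $ i ^ e" for i
  proof -
    have "x $ i = (\<Prod>j\<in>{1..r}. (s j ^ e) powi (E j $ i))" using t(2) s by simp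
    also have "\<dots> = (\<Prod>j\<in>{1..r}. (s j powi (E j $ i)) ^ e)"
      by (simp add: mult.commute flip: power_int_mult power_int_of_nat)
    finally show ?thesis by (simp add: y_def prod_power_distrib)
  qed
  ultimately show ?thesis using that by (simp add: vec_eq_iff)
qed

section \<open>Vanishing on torsion cosets\<close>

text \<open>Dedekind's argument, by eliminating one character from the relation at a time. The
  functions live on the whole monoid but are multiplicative and pairwise distinguished on the
  multiplicatively closed set \<open>H\<close>.\<close>

lemma characters_independent:
  fixes \<Phi> :: "('g::monoid_mult \<Rightarrow> complex) set"
  assumes "finite \<Phi>" "1 \<in> H" "\<And>x y. x \<in> H \<Longrightarrow> y \<in> H \<Longrightarrow> x * y \<in> H"
    and "\<And>\<phi>. \<phi> \<in> \<Phi> \<Longrightarrow> \<phi> 1 = 1"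
    and "\<And>\<phi> x y. \<phi> \<in> \<Phi> \<Longrightarrow> x \<in> H \<Longrightarrow> y \<in> H \<Longrightarrow> \<phi> (x * y) = \<phi> x * \<phi> y"
    and "\<And>\<phi> \<psi>. \<phi> \<in> \<Phi> \<Longrightarrow> \<psi> \<in> \<Phi> \<Longrightarrow> \<phi> \<noteq> \<psi> \<Longrightarrow> \<exists>x\<in>H. \<phi> x \<noteq> \<psi> x"
    and "\<And>x. x \<in> H \<Longrightarrow> (\<Sum>\<phi>\<in>\<Phi>. c \<phi> * \<phi> x) = 0"
    and "\<phi> \<in> \<Phi>"
  shows "c \<phi> = 0"
  using assms(1,4-)
proof (induction \<Phi> arbitrary: c \<phi> rule: finite_induct)
  case empty
  then show ?case by simp
next
  case (insert \<psi> \<Phi>)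
  have tail: "c \<theta> = 0" if \<theta>: "\<theta> \<in> \<Phi>" for \<theta>
  proof -
    have "\<theta> \<noteq> \<psi>" using \<theta> insert.hyps by blast
    then obtain y where y: "y \<in> H" "\<theta> y \<noteq> \<psi> y"
      using insert.prems(3)[of \<theta> \<psi>] \<theta> by blast
    have "c \<theta> * (\<theta> y - \<psi> y) = 0"
    \<comment> \<open>Subtracting \<open>\<psi> y\<close> times the relation at \<open>x\<close>
      from the relation at \<open>y * x\<close> cancels the term of \<open>\<psi>\<close> and leaves
      these coefficients.\<close>
    proof (rule insert.IH[where c = "\<lambda>\<phi>. c \<phi> * (\<phi> y - \<psi> y)"])
      fix x assume x: "x \<in> H"
      have "(\<Sum>\<phi>\<in>insert \<psi> \<Phi>. c \<phi> * \<phi> (y * x)) - \<psi> y * (\<Sum>\<phi>\<in>insert \<psi> \<Phi>. c \<phi> * \<phi> x) = 0"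
        using insert.prems(4) assms(3) x y(1) by simp
      also have "(\<Sum>\<phi>\<in>insert \<psi> \<Phi>. c \<phi> * \<phi> (y * x)) = (\<Sum>\<phi>\<in>insert \<psi> \<Phi>. c \<phi> * (\<phi> y * \<phi> x))"
        using insert.prems(2) x y(1) by (intro sum.cong) auto
      finally show "(\<Sum>\<phi>\<in>\<Phi>. c \<phi> * (\<phi> y - \<psi> y) * \<phi> x) = 0"
        using insert.hyps by (simp add: algebra_simps sum_subtractf sum_distrib_left)
    qed (use insert.prems \<theta> in auto)
    then show ?thesis using y(2) by simp
  qed
  have "(\<Sum>\<phi>\<in>insert \<psi> \<Phi>. c \<phi> * \<phi> 1) = 0" by (rule insert.prems(4)[OF assms(2)])
  moreover have "(\<Sum>\<phi>\<in>\<Phi>. c \<phi> * \<phi> 1) = 0" using tail by (intro sum.neutral) simp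
  ultimately have "c \<psi> = 0" using insert.hyps insert.prems(1)[of \<psi>] by simp
  then show ?case using tail insert.prems(5) by blast
qed

text \<open>Split off a minimal nonempty subset with vanishing \<open>w\<close>-sum; the complement
  again has vanishing \<open>w\<close>-sum, so induction on the set applies to it.\<close>

lemma sum_eq_0_if_minimal_blocks:
  fixes v w :: "'i \<Rightarrow> complex"
  assumes "finite S" "sum w S = 0"
    and "\<And>B. B \<subseteq> S \<Longrightarrow> B \<noteq> {} \<Longrightarrow> sum w B = 0 \<Longrightarrow>
      (\<And>T. T \<subset> B \<Longrightarrow> T \<noteq> {} \<Longrightarrow> sum w T \<noteq> 0) \<Longrightarrow> sum v B = 0"
  shows "sum v S = 0"
  using assms
proof (induction S rule: finite_psubset_induct)
  case (psubset S)
  show ?case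
  proof (cases "S = {}")
    case True
    then show ?thesis by simp
  next
    case False
    define \<B> where "\<B> = {B. B \<subseteq> S \<and> B \<noteq> {} \<and> sum w B = 0}"
    have "finite \<B>" "\<B> \<noteq> {}" using psubset False by (auto simp: \<B>_def)
    then obtain B where B: "B \<in> \<B>" "\<And>T. T \<in> \<B> \<Longrightarrow> T \<le> B \<Longrightarrow> B = T"
      using finite_has_minimal[of \<B>] by blast
    then have "sum v B = 0"
      by (intro psubset.prems(2)) (auto simp: \<B>_def)
    moreover have "sum v (S - B) = 0"
    proof (rule psubset.IH)
      show "S - B \<subset> S" using B by (auto simp: \<B>_def)
      show "sum w (S - B) = 0"
        using B psubset by (simp add: sum_diff \<B>_def)
      show "sum v B' = 0" if "B' \<subseteq> S - B" "B' \<noteq> {}" "sum w B' = 0"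
        "\<And>T. T \<subset> B' \<Longrightarrow> T \<noteq> {} \<Longrightarrow> sum w T \<noteq> 0" for B'
        using that by (intro psubset.prems(2)) auto
    qed
    ultimately show ?thesis
      using B psubset.hyps(1) by (simp add: sum_diff \<B>_def)
  qed
qed

abbreviation int_vec :: "nat ^ 'n \<Rightarrow> int ^ 'n" where
  "int_vec i \<equiv> (\<chi> a. int (i $ a))"

lemma mpoly_eval_monomial:
  "mpoly_eval p x = (\<Sum>i\<in>Poly_Mapping.keys p. of_rat (Poly_Mapping.lookup p i) * monomial x (int_vec i))"
  by (simp add: mpoly_eval_def monomial_def)

text \<open>A minimal vanishing subsum of \<open>p\<close> at \<open>\<omega>\<close> among
  monomials that restrict to the same character of \<open>H\<close>. The latter property passes to
  subsets, so minimality inside the class is minimality among all subsets.\<close>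

definition minimal_block ::
    "'n::finite rat_mpoly \<Rightarrow> complex ^ 'n \<Rightarrow> (complex ^ 'n) set \<Rightarrow> (nat ^ 'n) set \<Rightarrow> bool" where
  "minimal_block p \<omega> H B \<longleftrightarrow>
     B \<subseteq> Poly_Mapping.keys p \<and> B \<noteq> {} \<and>
     (\<Sum>i\<in>B. of_rat (Poly_Mapping.lookup p i) * monomial \<omega> (int_vec i)) = 0 \<and>
     (\<forall>T. T \<subset> B \<and> T \<noteq> {} \<longrightarrow> (\<Sum>i\<in>T. of_rat (Poly_Mapping.lookup p i) * monomial \<omega> (int_vec i)) \<noteq> 0) \<and>
     (\<forall>i\<in>B. \<forall>j\<in>B. \<forall>h\<in>H. monomial h (int_vec i) = monomial h (int_vec j))"

text \<open>Independence of characters makes the coefficients at \<open>\<omega>\<close> sum to zero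
  over each class of monomials agreeing on \<open>H\<close>. Each class sum decomposes into minimal
  blocks, and from a block the constant value of the monomials at \<open>x\<close> can be factored
  out.\<close>

lemma mpoly_eval_eq_0_if_constant_on_blocks:
  assumes H: "1 \<in> H" "\<And>x y. x \<in> H \<Longrightarrow> y \<in> H \<Longrightarrow> x * y \<in> H"
    and zero: "\<And>h. h \<in> H \<Longrightarrow> mpoly_eval p (\<omega> * h) = 0"
    and const: "\<And>B i j. minimal_block p \<omega> H B \<Longrightarrow> i \<in> B \<Longrightarrow> j \<in> B \<Longrightarrow>
      monomial x (int_vec i) = monomial x (int_vec j)"
  shows "mpoly_eval p (\<omega> * x) = 0"
proof -
  define S where "S = Poly_Mapping.keys p"
  define w where "w = (\<lambda>i. of_rat (Poly_Mapping.lookup p i) * monomial \<omega> (int_vec i))"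
  \<comment> \<open>The default \<open>0\<close> outside \<open>H\<close> makes equality of these
    functions the same as equality of the characters on \<open>H\<close>.\<close>
  define cls where "cls = (\<lambda>i h. if h \<in> H then monomial h (int_vec i) else 0)"
  have fin: "finite S" by (simp add: S_def)
  have eval: "mpoly_eval p (\<omega> * y) = (\<Sum>i\<in>S. w i * monomial y (int_vec i))" for y
    by (simp add: mpoly_eval_monomial S_def w_def monomial_mult mult.assoc)
  have class_sum: "(\<Sum>i | i \<in> S \<and> cls i = \<phi>. w i) = 0" if "\<phi> \<in> cls ` S" for \<phi>
  proof (rule characters_independent[of "cls ` S" H "\<lambda>\<phi>. \<Sum>i | i \<in> S \<and> cls i = \<phi>. w i"])
    fix h assume h: "h \<in> H"
    have "0 = (\<Sum>i\<in>S. w i * monomial h (int_vec i))" using zero[OF h] eval by simp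
    also have "\<dots> = (\<Sum>\<phi>\<in>cls ` S. \<Sum>i | i \<in> S \<and> cls i = \<phi>. w i * monomial h (int_vec i))"
      by (rule sum.image_gen[OF fin])
    also have "\<dots> = (\<Sum>\<phi>\<in>cls ` S. (\<Sum>i | i \<in> S \<and> cls i = \<phi>. w i) * \<phi> h)"
      unfolding sum_distrib_right
    proof (intro sum.cong refl)
      fix \<phi> i assume "i \<in> {i \<in> S. cls i = \<phi>}"
      then have "cls i = \<phi>" by simp
      then show "w i * monomial h (int_vec i) = w i * \<phi> h" using h by (auto simp: cls_def)
    qed
    finally show "(\<Sum>\<phi>\<in>cls ` S. (\<Sum>i | i \<in> S \<and> cls i = \<phi>. w i) * \<phi> h) = 0" by simp
  next
    fix \<phi> \<psi> assume "\<phi> \<in> cls ` S" "\<psi> \<in> cls ` S" "\<phi> \<noteq> \<psi>"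
    then show "\<exists>x\<in>H. \<phi> x \<noteq> \<psi> x" by (auto simp: cls_def fun_eq_iff split: if_splits)
  qed (use fin H that in \<open>auto simp: cls_def monomial_mult\<close>)
  have "(\<Sum>i | i \<in> S \<and> cls i = \<phi>. w i * monomial x (int_vec i)) = 0" if "\<phi> \<in> cls ` S" for \<phi>
  proof (rule sum_eq_0_if_minimal_blocks[OF _ class_sum[OF that]])
    fix B assume B: "B \<subseteq> {i \<in> S. cls i = \<phi>}" "B \<noteq> {}" "sum w B = 0"
      "\<And>T. T \<subset> B \<Longrightarrow> T \<noteq> {} \<Longrightarrow> sum w T \<noteq> 0"
    have "monomial h (int_vec i) = monomial h (int_vec j)" if "i \<in> B" "j \<in> B" "h \<in> H" for i j h
    proof -
      have "cls i = \<phi>" "cls j = \<phi>" using B(1) that by auto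
      then have "cls i h = cls j h" by simp
      then show ?thesis using that by (simp add: cls_def)
    qed
    then have "minimal_block p \<omega> H B"
      using B unfolding minimal_block_def S_def w_def by blast
    moreover obtain j where "j \<in> B" using B(2) by blast
    ultimately have "monomial x (int_vec i) = monomial x (int_vec j)" if "i \<in> B" for i
      using const that by blast
    then have "(\<Sum>i\<in>B. w i * monomial x (int_vec i)) = sum w B * monomial x (int_vec j)"
      by (simp add: sum_distrib_right)
    then show "(\<Sum>i\<in>B. w i * monomial x (int_vec i)) = 0" using B(3) by simp
  qed (use fin in auto)
  then have "(\<Sum>i\<in>S. w i * monomial x (int_vec i)) = 0"
    unfolding sum.image_gen[OF fin, of _ cls] by (intro sum.neutral) blast
  then show ?thesis by (simp add: eval)
qed

lemma Gm_nat_pow: "x [^]\<^bsub>Gm\<^esub> n = (\<chi> i. x $ i ^ n)"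
  by (induction n) (auto simp: Gm_def nat_pow_def vec_eq_iff mult.commute)

lemma coset_exponent_if_power_mem:
  fixes H :: "(complex ^ 'n::finite) set"
  assumes "subtorus r H" "\<And>i. \<omega> $ i \<noteq> 0" "(\<chi> i. \<omega> $ i ^ n) \<in> H" "n > 0"
  shows "coset_exponent H (\<omega> <#\<^bsub>Gm\<^esub> H) n"
proof -
  interpret comm_group "Gm :: (complex ^ 'n) monoid" by (rule comm_group_Gm)
  have sub: "subgroup H Gm" using assms(1) by (rule subgroup_subtorus)
  then interpret normal H Gm by (rule subgroup_imp_normal)
  interpret Q: group "Gm Mod H" by (rule factorgroup_is_group)
  have \<omega>: "\<omega> \<in> carrier Gm" using assms(2) by (simp add: Gm_def)
  have C: "\<omega> <#\<^bsub>Gm\<^esub> H = H #>\<^bsub>Gm\<^esub> \<omega>"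
    by (simp add: l_coset_def r_coset_def Gm_def mult.commute)
  have car: "H #>\<^bsub>Gm\<^esub> \<omega> \<in> carrier (Gm Mod H)"
    using \<omega> by (auto simp: FactGroup_def RCOSETS_def)
  have "(H #>\<^bsub>Gm\<^esub> \<omega>) [^]\<^bsub>Gm Mod H\<^esub> n = H #>\<^bsub>Gm\<^esub> (\<omega> [^]\<^bsub>Gm\<^esub> n)"
    using hom_nat_pow[OF r_coset_hom_Mod \<omega> is_group Q.is_group] by simp
  also have "\<dots> = H"
    using \<omega> assms(3) sub by (intro coset_join2) (auto simp: Gm_nat_pow[symmetric])
  also have "\<dots> = \<one>\<^bsub>Gm Mod H\<^esub>" by (simp add: FactGroup_def)
  finally have "Q.ord (H #>\<^bsub>Gm\<^esub> \<omega>) dvd n" using Q.pow_eq_id[OF car] by simp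
  then show ?thesis using assms(4) by (simp add: coset_exponent_def C)
qed

section \<open>The exponent bound\<close>

text \<open>Stars and bars: the slack \<open>d - (\<Sum>j\<in>UNIV. i $ j)\<close>, appended as an
  extra entry, turns the vectors into lists of length \<open>CARD('n) + 1\<close> with sum exactly
  \<open>d\<close>.\<close>

lemma card_bounded_sum_vectors:
  "finite {i :: nat ^ 'n::finite. (\<Sum>j\<in>UNIV. i $ j) \<le> d}"
  "card {i :: nat ^ 'n::finite. (\<Sum>j\<in>UNIV. i $ j) \<le> d} \<le> (CARD('n) + d) choose d"
proof -
  define A where "A = {i :: nat ^ 'n. (\<Sum>j\<in>UNIV. i $ j) \<le> d}"
  define L where "L = {l::nat list. length l = CARD('n) + 1 \<and> sum_list l = d}"
  obtain xs :: "'n list" where xs: "set xs = UNIV" "distinct xs"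
    using finite_distinct_list[of "UNIV :: 'n set"] by auto
  then have len: "length xs = CARD('n)" by (metis distinct_card)
  have card_L: "card L = (CARD('n) + d) choose d"
    unfolding L_def card_length_sum_list by (simp add: add.commute)
  \<comment> \<open>An infinite set would have cardinality \<open>0\<close>, whereas the binomial
    coefficient is positive.\<close>
  then have "finite L" by (metis card.infinite binomial_eq_0_iff le_add2 not_less)
  define \<phi> where "\<phi> = (\<lambda>i :: nat ^ 'n. map (($) i) xs @ [d - (\<Sum>j\<in>UNIV. i $ j)])"
  have "inj_on \<phi> A"
    using xs by (auto simp: inj_on_def \<phi>_def vec_eq_iff)
  moreover have "\<phi> ` A \<subseteq> L"
    using xs by (auto simp: \<phi>_def L_def A_def len sum_list_distinct_conv_sum_set)
  ultimately show "finite A" "card A \<le> (CARD('n) + d) choose d"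
    using card_inj_on_le[of \<phi> A L] inj_on_finite[of \<phi> A L] \<open>finite L\<close> card_L by auto
qed

lemma common_root_of_unity_order:
  fixes x :: "'i::finite \<Rightarrow> complex"
  assumes "\<And>i. \<exists>q>0. x i ^ q = 1"
  shows "\<exists>q>0. \<forall>i. x i ^ q = 1"
proof -
  obtain q where q: "\<And>i. q i > 0 \<and> x i ^ q i = 1" using assms by metis
  have "x i ^ (\<Prod>i\<in>UNIV. q i) = 1" for i
  proof -
    have "q i dvd (\<Prod>i\<in>UNIV. q i)" by (intro dvd_prodI) auto
    then obtain k where "(\<Prod>i\<in>UNIV. q i) = q i * k" by (elim dvdE)
    then show ?thesis using q by (simp add: power_mult)
  qed
  moreover have "(\<Prod>i\<in>UNIV. q i) > 0" using q by (intro prod_pos) auto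
  ultimately show ?thesis by blast
qed

section \<open>Degree and diameter of the support\<close>

lemma finite_system_support: "finite (system_support L f)"
proof -
  have "system_support L f = (\<Union>l\<in>{1..L}. Poly_Mapping.keys (f l))"
    by (auto simp: system_support_def in_keys_iff)
  then show ?thesis by simp
qed

lemma system_support_degree:
  assumes "i \<in> system_support L f"
  shows "(\<Sum>j\<in>UNIV. i $ j) \<le> system_degree L f"
proof -
  obtain l where l: "l \<in> {1..L}" "i \<in> Poly_Mapping.keys (f l)"
    using assms by (auto simp: system_support_def in_keys_iff)
  have "(\<Sum>j\<in>UNIV. i $ j) \<le> mpoly_total_degree (f l)"
    unfolding mpoly_total_degree_def using l(2) by (intro Max_ge) auto
  also have "\<dots> \<le> system_degree L f"
    unfolding system_degree_def using l(1) by (intro Max_ge) auto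
  finally show ?thesis .
qed

lemma norm_diff_le_exponent_diameter:
  fixes S :: "(nat ^ 'n::finite) set"
  assumes "finite S" "i \<in> S" "j \<in> S"
  shows "norm (real_vec (int_vec i - int_vec j)) \<le> exponent_diameter S"
proof -
  define g where "g = (\<lambda>i :: nat ^ 'n. (\<chi> a. real (i $ a)) :: real ^ 'n)"
  have "real_vec (int_vec i - int_vec j) = g i - g j" by (simp add: g_def vec_eq_iff)
  then have "norm (real_vec (int_vec i - int_vec j)) = dist (g i) (g j)" by (simp add: dist_norm)
  also have "\<dots> \<le> diameter (g ` S)"
    using assms by (intro diameter_bounded_bound finite_imp_bounded) auto
  finally show ?thesis by (simp add: exponent_diameter_def g_def)
qed

theorem theorem8:
  fixes f :: "nat \<Rightarrow> 'n::finite rat_mpoly"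
    and L d N P :: nat
    and V :: "(complex ^ 'n) set"
    and D :: real
  assumes "V = Gm_variety L f"
    and "d = system_degree L f"
    and "D = exponent_diameter (system_support L f)"
    and "N = card (system_support L f)"
    and "P = (\<Prod>p | prime p \<and> p \<le> N. p)"
  shows "N \<le> (CARD('n) + d) choose d \<and>
    (\<forall>k H C. k \<le> CARD('n) \<and> maximal_torsion_coset V (CARD('n) - k) H C \<longrightarrow>
       (\<exists>m::nat. m > 0 \<and> real m \<le> D ^ (2 * k) * sqrt (real k) ^ k \<and> coset_exponent H C (m * P)))"
proof (intro conjI allI impI)
  have "system_support L f \<subseteq> {i. (\<Sum>j\<in>UNIV. i $ j) \<le> d}"
    using system_support_degree assms(2) by blast
  then have "N \<le> card {i :: nat ^ 'n. (\<Sum>j\<in>UNIV. i $ j) \<le> d}"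
    unfolding assms(4) by (rule card_mono[OF card_bounded_sum_vectors(1)])
  also note card_bounded_sum_vectors(2)
  finally show "N \<le> (CARD('n) + d) choose d" .
next
  fix k H C
  assume "k \<le> CARD('n) \<and> maximal_torsion_coset V (CARD('n) - k) H C"
  then have k: "k \<le> CARD('n)" and mx: "maximal_torsion_coset V (CARD('n) - k) H C"
    by simp_all
  note mx' = mx[unfolded maximal_torsion_coset_def]
  note tc = mx'[THEN conjunct1] and CV = mx'[THEN conjunct2, THEN conjunct1]
    and nex = mx'[THEN conjunct2, THEN conjunct2]
  from tc obtain \<omega> where sub: "subtorus (CARD('n) - k) H"
    and \<omega>: "\<And>i. \<exists>q>0. (\<omega> $ i) ^ q = 1" and C: "C = \<omega> <#\<^bsub>Gm\<^esub> H"
    unfolding torsion_coset_def by blast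
  have \<omega>_nz: "\<omega> $ i \<noteq> 0" for i
    using \<omega>[of i] by (auto simp: power_0_left)
  have coset: "\<omega> <#\<^bsub>Gm\<^esub> H' = (\<lambda>h. \<omega> * h) ` H'" for H'
    by (auto simp: l_coset_def Gm_def)
  have one: "1 \<in> H'" and mult: "\<And>x y. x \<in> H' \<Longrightarrow> y \<in> H' \<Longrightarrow> x * y \<in> H'"
    and nz: "\<And>h i. h \<in> H' \<Longrightarrow> h $ i \<noteq> 0" if "subtorus r H'" for r and H' :: "(complex ^ 'n) set"
  proof -
    interpret subgroup H' Gm using that by (rule subgroup_subtorus)
    show "1 \<in> H'" using one_closed by (simp add: Gm_def)
    show "x * y \<in> H'" if "x \<in> H'" "y \<in> H'" for x y using m_closed[OF that] by (simp add: Gm_def)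
    show "h $ i \<noteq> 0" if "h \<in> H'" for h i using subset that by (auto simp: Gm_def)
  qed
  \<comment> \<open>The blocks of all the equations are collected; each lies in the common support,
    so every difference has norm at most \<open>D\<close>.\<close>
  define M where "M = {int_vec i - int_vec j | i j l B. l \<in> {1..L} \<and> minimal_block (f l) \<omega> H B \<and> i \<in> B \<and> j \<in> B}"
  have block_support: "B \<subseteq> system_support L f" if "l \<in> {1..L}" "minimal_block (f l) \<omega> H B" for l B
    using that by (auto simp: minimal_block_def system_support_def in_keys_iff)
  have bound: "norm (real_vec m) \<le> D" if "m \<in> M" for m
    using that block_support norm_diff_le_exponent_diameter[OF finite_system_support]
    unfolding M_def assms(3) by blast
  obtain H' :: "(complex ^ 'n) set" and k' e where H':
    "k' \<le> CARD('n)" "subtorus (CARD('n) - k') H'" "e > 0" "real e \<le> D ^ (2 * k')"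
    and one_H': "\<forall>x\<in>H'. \<forall>m\<in>M. monomial x m = 1"
    and power_H': "\<forall>x. (\<forall>i. x $ i \<noteq> 0) \<and> (\<forall>m\<in>M. monomial x m = 1) \<longrightarrow> (\<chi> i. x $ i ^ e) \<in> H'"
    by (rule annihilator_subtorus[of M D]) (erule bound, rule that)
  have M_one: "monomial x m = 1"
    if hyps: "m \<in> M" "\<And>i. x $ i \<noteq> 0" "\<And>l B i j. l \<in> {1..L} \<Longrightarrow> minimal_block (f l) \<omega> H B \<Longrightarrow> i \<in> B \<Longrightarrow> j \<in> B \<Longrightarrow>
      monomial x (int_vec i) = monomial x (int_vec j)" for x m
  proof -
    obtain i j l B where "m = int_vec i - int_vec j" "l \<in> {1..L}" "minimal_block (f l) \<omega> H B" "i \<in> B" "j \<in> B"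
      using hyps(1) unfolding M_def by blast
    moreover from this have "monomial x (int_vec i) = monomial x (int_vec j)" using hyps(3) by blast
    ultimately show ?thesis
      using monomial_diff[OF hyps(2)] monomial_nonzero[OF hyps(2)] by simp
  qed
  \<comment> \<open>Points of \<open>H\<close> are annihilated by \<open>M\<close>, since the
    monomials of a block agree on \<open>H\<close>; hence their \<open>e\<close>-th powers lie in
    \<open>H'\<close>. By divisibility of \<open>H\<close> these powers exhaust
    \<open>H\<close>.\<close>
  have "H \<subseteq> H'"
  proof
    fix h assume "h \<in> H"
    then obtain y where y: "y \<in> H" "h = (\<chi> i. y $ i ^ e)"
      using subtorus_root[OF sub _ H'(3)] by blast
    have "monomial y m = 1" if "m \<in> M" for m
    proof (rule M_one[OF that])
      show "y $ i \<noteq> 0" for i using y(1) by (rule nz[OF sub])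
      fix l B i j assume "minimal_block (f l) \<omega> H B" "i \<in> B" "j \<in> B"
      then show "monomial y (int_vec i) = monomial y (int_vec j)"
        using y(1) unfolding minimal_block_def by blast
    qed
    then show "h \<in> H'" unfolding y(2) using power_H' nz[OF sub y(1)] by blast
  qed
  \<comment> \<open>Annihilation by \<open>M\<close> means that the monomials of each block take one
    value at a point of \<open>H'\<close>, so every equation persists on the larger coset and
    maximality forces equality.\<close>
  have "\<omega> <#\<^bsub>Gm\<^esub> H' \<subseteq> V"
  proof
    fix z assume "z \<in> \<omega> <#\<^bsub>Gm\<^esub> H'"
    then obtain x where x: "x \<in> H'" "z = \<omega> * x" by (auto simp: coset)
    have "mpoly_eval (f l) (\<omega> * x) = 0" if l: "l \<in> {1..L}" for l
    proof (rule mpoly_eval_eq_0_if_constant_on_blocks[OF one[OF sub] mult[OF sub]])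
      fix h assume "h \<in> H"
      then have "\<omega> * h \<in> V" using CV by (auto simp: C coset)
      then show "mpoly_eval (f l) (\<omega> * h) = 0" using l by (simp add: assms(1) Gm_variety_def)
    next
      fix B i j assume B: "minimal_block (f l) \<omega> H B" "i \<in> B" "j \<in> B"
      then have "int_vec i - int_vec j \<in> M" using l unfolding M_def by blast
      then have "monomial x (int_vec i - int_vec j) = 1" using one_H' x(1) by blast
      then show "monomial x (int_vec i) = monomial x (int_vec j)"
        using monomial_nonzero[OF nz[OF H'(2) x(1)]] by (simp add: monomial_diff nz[OF H'(2) x(1)])
    qed
    moreover have "\<omega> * x \<in> carrier Gm" using \<omega>_nz nz[OF H'(2) x(1)] by (simp add: Gm_def)
    ultimately show "z \<in> V" by (simp add: x(2) assms(1) Gm_variety_def)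
  qed
  moreover have "torsion_coset (CARD('n) - k') H' (\<omega> <#\<^bsub>Gm\<^esub> H')"
    using H'(2) \<omega> by (auto simp: torsion_coset_def)
  ultimately have "\<not> C \<subset> \<omega> <#\<^bsub>Gm\<^esub> H'" using nex by auto
  moreover have "C \<subseteq> \<omega> <#\<^bsub>Gm\<^esub> H'" using \<open>H \<subseteq> H'\<close> by (auto simp: C coset)
  ultimately have "(\<lambda>h. \<omega> * h) ` H = (\<lambda>h. \<omega> * h) ` H'" by (auto simp: C coset)
  moreover have "inj (\<lambda>h. \<omega> * h)"
    using \<omega>_nz by (auto simp: inj_def vec_eq_iff)
  ultimately have HH': "H = H'" by (simp add: inj_image_eq_iff)
  \<comment> \<open>Equal sets have equal dimensions; as both \<open>k\<close> and \<open>k'\<close>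
    are at most \<open>CARD('n)\<close>, the truncated subtraction can be cancelled.\<close>
  have "CARD('n) - k = CARD('n) - k'"
    using dim_log_subtorus[OF sub] dim_log_subtorus[OF H'(2)] by (simp add: HH')
  then have "k' = k" using k H'(1) by linarith
  obtain q where q: "q > 0" "\<And>i. \<omega> $ i ^ q = 1"
    using common_root_of_unity_order[of "($) \<omega>"] \<omega> by blast
  have root: "monomial \<omega> m ^ q = 1" for m
    unfolding monomial_power[symmetric] by (simp add: q(2) monomial_def)
  have P: "P > 0" unfolding assms(5) by (intro prod_pos) (auto simp: prime_gt_0_nat)
  \<comment> \<open>Mann's theorem, applied to each block, makes \<open>\<omega>\<close> raised to
    the power \<open>P\<close> a point annihilated by \<open>M\<close>; a further
    \<open>e\<close>-th power then lies in \<open>H'\<close>, which is \<open>H\<close>.\<close>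
  have "monomial (\<chi> i. \<omega> $ i ^ P) m = 1" if "m \<in> M" for m
  proof (rule M_one[OF that])
    show "(\<chi> i. \<omega> $ i ^ P) $ i \<noteq> 0" for i using \<omega>_nz by simp
    fix l B i j assume B: "l \<in> {1..L}" "minimal_block (f l) \<omega> H B" "i \<in> B" "j \<in> B"
    have "monomial \<omega> (int_vec i) ^ P = monomial \<omega> (int_vec j) ^ P"
      unfolding assms(5)
    proof (rule mann[where S = B and a = "Poly_Mapping.lookup (f l)"])
      show "finite B" "card B \<le> N"
        unfolding assms(4) using block_support[OF B(1,2)] finite_system_support
        by (blast intro: finite_subset, blast intro: card_mono)
      show "\<exists>q>0. monomial \<omega> (int_vec i) ^ q = 1" for i using q(1) root by blast
      note block = B(2)[unfolded minimal_block_def]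
      show "(\<Sum>i\<in>B. of_rat (Poly_Mapping.lookup (f l) i) * monomial \<omega> (int_vec i)) = 0"
        using block by (elim conjE)
      show "(\<Sum>i\<in>T. of_rat (Poly_Mapping.lookup (f l) i) * monomial \<omega> (int_vec i)) \<noteq> 0"
        if "T \<subset> B" "T \<noteq> {}" for T
        using block that by blast
    qed fact+
    then show "monomial (\<chi> i. \<omega> $ i ^ P) (int_vec i) = monomial (\<chi> i. \<omega> $ i ^ P) (int_vec j)"
      by (simp add: monomial_power)
  qed
  then have "(\<chi> i. (\<chi> i. \<omega> $ i ^ P) $ i ^ e) \<in> H'"
    using \<omega>_nz by (intro power_H'[rule_format]) auto
  then have "(\<chi> i. \<omega> $ i ^ (e * P)) \<in> H"
    by (simp add: HH' mult.commute flip: power_mult)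
  then have "coset_exponent H C (e * P)"
    unfolding C using P H'(3) by (intro coset_exponent_if_power_mem[OF sub \<omega>_nz]) auto
  moreover have "real e \<le> D ^ (2 * k) * sqrt (real k) ^ k"
  proof -
    \<comment> \<open>For \<open>k = 0\<close> this is \<open>0 ^ 0 = 1\<close>. The even power of
      \<open>D\<close> is nonnegative, so multiplying it by this factor can only enlarge the
      bound.\<close>
    have "sqrt (real k) ^ k \<ge> 1" by (cases "k = 0") (auto intro: one_le_power)
    then have "D ^ (2 * k) * 1 \<le> D ^ (2 * k) * sqrt (real k) ^ k"
      by (intro mult_left_mono) (auto simp: power_mult)
    then show ?thesis using H'(4) \<open>k' = k\<close> by simp
  qed
  ultimately show "\<exists>m::nat. m > 0 \<and> real m \<le> D ^ (2 * k) * sqrt (real k) ^ k \<and> coset_exponent H C (m * P)"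
    using H'(3) by blast
qed

end
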